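(* Let $p\ge1$, $q\ge2$, $d_h,\rho_h>0$ ($1\le h\le q$) with $\rho_1,\dots,\rho_q$ pairwise distinct, and $\xi_1,\dots,\xi_p\in\mathbb R$ with $\xi_i+\rho_h>0$ for all $i,h$. Let $\boldsymbol m\in\mathbb N^q$ (all $m_h\ge1$) be near the diagonal ($|m_i-m_j|\le1$) and $\boldsymbol n\in\mathbb N_0^p$ with $|\boldsymbol m|=|\boldsymbol n|+1$. Let $B_1,\dots,B_q$ be the polynomial components, $\deg B_j\le m_j-1$, of the form $\mathcal B=\sum_jB_jF_j$ normalized by $$\int_0^\infty\mathrm e^{-zy}\mathcal B(y)\,\mathrm dy=-\frac{\prod_i(\xi_i-z)^{n_i}}{\prod_h(z+\rho_h)^{d_h+m_h}}.$$ With $\kappa_J$, $x_h^{(J)}$ and the polynomials $\mathcal V_N^{J,j}(a;y)$ defined in the context, for every $j\in\{1,\dots,q\}$ and any $h\ne j$, $$B_j(y)=\kappa_j\mathcal V^{j,h}_{m_j-1}(d_j-1;y)-\frac{\kappa_jd_jx_h^{(j)}}{d_j+1}\mathcal V^{j,h}_{m_j-2}(d_j;y)-d_j\sum_{J\ne j}\frac{\kappa_Jx_j^{(J)}}{d_J+1}\mathcal V^{J,j}_{m_J-2}(d_J;y).$$ This expression is independent of $h$, belongs to $\mathbb P_{m_j-1}$, and represents each component by at most $q+1$ terminating Srivastava–Daoust functions of $p+2q-1$ arguments.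
   Context: $(a)_k=a(a+1)\cdots(a+k-1)$; $\mathbb P_N$ = polynomials of degree $\le N$. Rows: $F_j=g_{\rho_1,d_1+\delta_{1,j}}*_+\cdots*_+g_{\rho_q,d_q+\delta_{q,j}}$ with $g_{\rho,d}(y)=\frac{y^{d-1}\mathrm e^{-\rho y}}{\Gamma(d)}\mathbf 1_{(0,\infty)}(y)$ and $(f*_+g)(y)=\int_0^yf(u)g(y-u)\,\mathrm du$. Constants: $c_{i,J}=\xi_i+\rho_J$, $x_h^{(J)}=-\frac1{\rho_h-\rho_J}$ ($h\ne J$), $\kappa_J=-\dfrac{\prod_{i=1}^pc_{i,J}^{n_i}}{\prod_{h\ne J}(\rho_h-\rho_J)^{m_h}}$. For distinct row indices $J,j$ let $I_{J,j}=\{1,\dots,q\}\setminus\{J,j\}$, $r_0=p+q-1$, $t_0=q-2$, $R=p+2q-1=r_0+t_0+2$. Order the $R$ summation indices as $\boldsymbol k=(\boldsymbol\eta,\boldsymbol\beta,r,s)\in\mathbb N_0^R$: the first $p$ entries of $\boldsymbol\eta$ correspond to columns $1,\dots,p$, its remaining $q-1$ entries to rows $h\ne J$, and $\boldsymbol\beta$ to $h\in I_{J,j}$ (increasing order in each group). Coefficient vectors ($\mathbf 1_d$, $\mathbf 0_d$ are the all-one and zero vectors of length $d$): $\boldsymbol e=(\mathbf 1_{r_0},\mathbf 1_{t_0},1,1)$, $\boldsymbol u=(\mathbf 0_{r_0},\mathbf 1_{t_0},1,1)$, $\boldsymbol v=(\mathbf 0_{r_0},\mathbf 1_{t_0},0,1)$.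 Put $\widetilde m_j=m_j$ and $\widetilde m_h=m_h+d_h$ for $h\in I_{J,j}$. Individual upper parameters ($R-1$ entries; the last index $s$ has none): $$\boldsymbol b^{J,j}=\bigl((-n_i)_{i=1}^p,(\widetilde m_h)_{h\ne J},(-d_h)_{h\in I_{J,j}},1\bigr).$$ Arguments: $$\boldsymbol z^{J,j}(y)=\Bigl(\bigl(-\tfrac1{c_{i,J}y}\bigr)_{i=1}^p,\bigl(-\tfrac{x_h^{(J)}}y\bigr)_{h\ne J},\bigl(-\tfrac{x_h^{(J)}}y\bigr)_{h\in I_{J,j}},-\tfrac{x_j^{(J)}}y,1\Bigr).$$ For $a>-1$, $N\in\mathbb N_0$, $$\mathcal V_N^{J,j}(a;y)=\frac{y^N}{N!}\sum_{\boldsymbol k\in\mathbb N_0^R}\frac{(-N)_{\boldsymbol e\cdot\boldsymbol k}\,(a+d_j+1)_{\boldsymbol u\cdot\boldsymbol k}\,(a+1)_{\boldsymbol v\cdot\boldsymbol k}}{(a+2)_{\boldsymbol u\cdot\boldsymbol k}\,(a+d_j+1)_{\boldsymbol v\cdot\boldsymbol k}}\prod_{\nu=1}^{R-1}(b^{J,j}_\nu)_{k_\nu}\prod_{\nu=1}^R\frac{(z^{J,j}_\nu(y))^{k_\nu}}{k_\nu!},$$ and $\mathcal V_{-1}^{J,j}(a;y)=0$. The series (without the prefactor $y^N/N!$) is a Srivastava–Daoust function of $R$ arguments; it terminates ($\boldsymbol e\cdot\boldsymbol k\le N$), and after multiplication by $y^N$ each term contains the nonnegative power $y^{N-|\boldsymbol\eta|-|\boldsymbol\beta|-r}$,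 so $\mathcal V_N^{J,j}(a;\cdot)$ is a polynomial, also defined at $y=0$. *)

theory Defs
  imports "HOL-Analysis.Analysis" "HOL-Computational_Algebra.Polynomial"
begin

(* Rows h, J, j range over {1..q} and columns i over {1..p}; families indexed by rows or columns
   are functions on nat, and their values outside these ranges are never used. *)

definition gamma_density :: "real \<Rightarrow> real \<Rightarrow> real \<Rightarrow> real" where
  "gamma_density \<rho> d y = (if y > 0 then y powr (d - 1) * exp (- \<rho> * y) / Gamma d else 0)"

definition conv_pos :: "(real \<Rightarrow> real) \<Rightarrow> (real \<Rightarrow> real) \<Rightarrow> real \<Rightarrow> real" where
  "conv_pos f g y = (LINT u:{0..y}|lborel. f u * g (y - u))"

definition row_weight :: "nat \<Rightarrow> (nat \<Rightarrow> real) \<Rightarrow> (nat \<Rightarrow> real) \<Rightarrow> nat \<Rightarrow> real \<Rightarrow> real" where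
  "row_weight q d \<rho> j =
     (let gs = map (\<lambda>h. gamma_density (\<rho> h) (d h + (if h = j then 1 else 0))) [1..<q+1]
      in foldl conv_pos (hd gs) (tl gs))"

definition linear_form ::
  "nat \<Rightarrow> (nat \<Rightarrow> real) \<Rightarrow> (nat \<Rightarrow> real) \<Rightarrow> (nat \<Rightarrow> real poly) \<Rightarrow> real \<Rightarrow> real" where
  "linear_form q d \<rho> B y = (\<Sum>j=1..q. poly (B j) y * row_weight q d \<rho> j y)"

definition ccol :: "(nat \<Rightarrow> real) \<Rightarrow> (nat \<Rightarrow> real) \<Rightarrow> nat \<Rightarrow> nat \<Rightarrow> real" where
  "ccol \<rho> \<xi> i J = \<xi> i + \<rho> J"

definition xrow :: "(nat \<Rightarrow> real) \<Rightarrow> nat \<Rightarrow> nat \<Rightarrow> real" where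
  "xrow \<rho> J h = - 1 / (\<rho> h - \<rho> J)"

definition kappa ::
  "nat \<Rightarrow> nat \<Rightarrow> (nat \<Rightarrow> real) \<Rightarrow> (nat \<Rightarrow> real) \<Rightarrow> (nat \<Rightarrow> nat) \<Rightarrow> (nat \<Rightarrow> nat) \<Rightarrow> nat \<Rightarrow> real" where
  "kappa p q \<rho> \<xi> m n J =
     - ((\<Prod>i=1..p. ccol \<rho> \<xi> i J ^ n i) / (\<Prod>h\<in>{1..q} - {J}. (\<rho> h - \<rho> J) ^ m h))"


definition dot :: "nat list \<Rightarrow> nat list \<Rightarrow> nat" where
  "dot w k = sum_list (map2 (*) w k)"

(* Srivastava--Daoust series in length z arguments.  A shared parameter (a, w) contributes the
   factor (a)_{w . k} to the numerator (list up) or denominator (list lo); an individual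
   parameter (b, w) in the nu-th list of iup or ilo contributes (b)_{w k_nu}. *)
definition sd_term ::
  "(real \<times> nat list) list \<Rightarrow> (real \<times> nat list) list \<Rightarrow>
   (real \<times> nat) list list \<Rightarrow> (real \<times> nat) list list \<Rightarrow> real list \<Rightarrow> nat list \<Rightarrow> real" where
  "sd_term up lo iup ilo z k =
     (\<Prod>(a, w)\<leftarrow>up. pochhammer a (dot w k)) / (\<Prod>(a, w)\<leftarrow>lo. pochhammer a (dot w k)) *
     (\<Prod>\<nu><length z.
        (\<Prod>(b, w)\<leftarrow>iup ! \<nu>. pochhammer b (w * k ! \<nu>)) /
        (\<Prod>(b, w)\<leftarrow>ilo ! \<nu>. pochhammer b (w * k ! \<nu>)) *
        ((z ! \<nu>) ^ (k ! \<nu>) / fact (k ! \<nu>)))"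

definition srivastava_daoust ::
  "(real \<times> nat list) list \<Rightarrow> (real \<times> nat list) list \<Rightarrow>
   (real \<times> nat) list list \<Rightarrow> (real \<times> nat) list list \<Rightarrow> real list \<Rightarrow> real" where
  "srivastava_daoust up lo iup ilo z =
     (\<Sum>\<^sub>\<infinity>k\<in>{k. length k = length z}. sd_term up lo iup ilo z k)"

definition sd_terminating ::
  "(real \<times> nat list) list \<Rightarrow> (real \<times> nat list) list \<Rightarrow>
   (real \<times> nat) list list \<Rightarrow> (real \<times> nat) list list \<Rightarrow> real list \<Rightarrow> bool" where
  "sd_terminating up lo iup ilo z \<longleftrightarrow>
     finite {k. length k = length z \<and> sd_term up lo iup ilo z k \<noteq> 0}"


definition rows_except :: "nat \<Rightarrow> nat set \<Rightarrow> nat list" where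
  "rows_except q S = filter (\<lambda>h. h \<notin> S) [1..<q+1]"

definition r0 :: "nat \<Rightarrow> nat \<Rightarrow> nat" where "r0 p q = p + q - 1"
definition t0 :: "nat \<Rightarrow> nat" where "t0 q = q - 2"

definition vec_e :: "nat \<Rightarrow> nat \<Rightarrow> nat list" where
  "vec_e p q = replicate (r0 p q) 1 @ replicate (t0 q) 1 @ [1, 1]"

definition vec_u :: "nat \<Rightarrow> nat \<Rightarrow> nat list" where
  "vec_u p q = replicate (r0 p q) 0 @ replicate (t0 q) 1 @ [1, 1]"

definition vec_v :: "nat \<Rightarrow> nat \<Rightarrow> nat list" where
  "vec_v p q = replicate (r0 p q) 0 @ replicate (t0 q) 1 @ [0, 1]"

definition mtilde :: "(nat \<Rightarrow> real) \<Rightarrow> (nat \<Rightarrow> nat) \<Rightarrow> nat \<Rightarrow> nat \<Rightarrow> real" where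
  "mtilde d m j h = (if h = j then real (m h) else real (m h) + d h)"

definition V_upper ::
  "nat \<Rightarrow> nat \<Rightarrow> (nat \<Rightarrow> real) \<Rightarrow> nat \<Rightarrow> nat \<Rightarrow> real \<Rightarrow> (real \<times> nat list) list" where
  "V_upper p q d j N a =
     [(- real N, vec_e p q), (a + d j + 1, vec_u p q), (a + 1, vec_v p q)]"

definition V_lower ::
  "nat \<Rightarrow> nat \<Rightarrow> (nat \<Rightarrow> real) \<Rightarrow> nat \<Rightarrow> real \<Rightarrow> (real \<times> nat list) list" where
  "V_lower p q d j a = [(a + 2, vec_u p q), (a + d j + 1, vec_v p q)]"

definition V_b ::
  "nat \<Rightarrow> nat \<Rightarrow> (nat \<Rightarrow> real) \<Rightarrow> (nat \<Rightarrow> nat) \<Rightarrow> (nat \<Rightarrow> nat) \<Rightarrow> nat \<Rightarrow> nat \<Rightarrow> real list" where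
  "V_b p q d m n J j =
     map (\<lambda>i. - real (n i)) [1..<p+1] @
     map (mtilde d m j) (rows_except q {J}) @
     map (\<lambda>h. - d h) (rows_except q {J, j}) @ [1]"

(* the trailing [] is the index s, which has no individual parameter *)
definition V_indiv ::
  "nat \<Rightarrow> nat \<Rightarrow> (nat \<Rightarrow> real) \<Rightarrow> (nat \<Rightarrow> nat) \<Rightarrow> (nat \<Rightarrow> nat) \<Rightarrow> nat \<Rightarrow> nat \<Rightarrow> (real \<times> nat) list list"
  where
  "V_indiv p q d m n J j = map (\<lambda>b. [(b, 1)]) (V_b p q d m n J j) @ [[]]"

definition V_args ::
  "nat \<Rightarrow> nat \<Rightarrow> (nat \<Rightarrow> real) \<Rightarrow> (nat \<Rightarrow> real) \<Rightarrow> nat \<Rightarrow> nat \<Rightarrow> real \<Rightarrow> real list" where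
  "V_args p q \<rho> \<xi> J j y =
     map (\<lambda>i. - 1 / (ccol \<rho> \<xi> i J * y)) [1..<p+1] @
     map (\<lambda>h. - xrow \<rho> J h / y) (rows_except q {J}) @
     map (\<lambda>h. - xrow \<rho> J h / y) (rows_except q {J, j}) @
     [- xrow \<rho> J j / y, 1]"

definition V_indiv_lower :: "nat \<Rightarrow> nat \<Rightarrow> (real \<times> nat) list list" where
  "V_indiv_lower p q = replicate (p + 2 * q - 1) []"

definition V_sd ::
  "nat \<Rightarrow> nat \<Rightarrow> (nat \<Rightarrow> real) \<Rightarrow> (nat \<Rightarrow> real) \<Rightarrow> (nat \<Rightarrow> real) \<Rightarrow> (nat \<Rightarrow> nat) \<Rightarrow> (nat \<Rightarrow> nat) \<Rightarrow>
   nat \<Rightarrow> nat \<Rightarrow> nat \<Rightarrow> real \<Rightarrow> real \<Rightarrow> real" where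
  "V_sd p q d \<rho> \<xi> m n J j N a y =
     srivastava_daoust (V_upper p q d j N a) (V_lower p q d j a)
       (V_indiv p q d m n J j) (V_indiv_lower p q) (V_args p q \<rho> \<xi> J j y)"

definition V_sd_terminating ::
  "nat \<Rightarrow> nat \<Rightarrow> (nat \<Rightarrow> real) \<Rightarrow> (nat \<Rightarrow> real) \<Rightarrow> (nat \<Rightarrow> real) \<Rightarrow> (nat \<Rightarrow> nat) \<Rightarrow> (nat \<Rightarrow> nat) \<Rightarrow>
   nat \<Rightarrow> nat \<Rightarrow> nat \<Rightarrow> real \<Rightarrow> real \<Rightarrow> bool" where
  "V_sd_terminating p q d \<rho> \<xi> m n J j N a y \<longleftrightarrow>
     sd_terminating (V_upper p q d j N a) (V_lower p q d j a)
       (V_indiv p q d m n J j) (V_indiv_lower p q) (V_args p q \<rho> \<xi> J j y)"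

(* The arguments contain 1/y, so the displayed series determines the polynomial through its
   values at y \<noteq> 0; existence and uniqueness are poly_V_poly and V_poly_unique below.
   The degree index is an int because V with index -1 occurs, and is 0. *)
definition V_poly ::
  "nat \<Rightarrow> nat \<Rightarrow> (nat \<Rightarrow> real) \<Rightarrow> (nat \<Rightarrow> real) \<Rightarrow> (nat \<Rightarrow> real) \<Rightarrow> (nat \<Rightarrow> nat) \<Rightarrow> (nat \<Rightarrow> nat) \<Rightarrow>
   nat \<Rightarrow> nat \<Rightarrow> int \<Rightarrow> real \<Rightarrow> real poly" where
  "V_poly p q d \<rho> \<xi> m n J j N a =
     (if N < 0 then 0
      else THE P. \<forall>y. y \<noteq> 0 \<longrightarrow>
        poly P y = y ^ nat N / fact (nat N) * V_sd p q d \<rho> \<xi> m n J j (nat N) a y)"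

definition component_formula ::
  "nat \<Rightarrow> nat \<Rightarrow> (nat \<Rightarrow> real) \<Rightarrow> (nat \<Rightarrow> real) \<Rightarrow> (nat \<Rightarrow> real) \<Rightarrow> (nat \<Rightarrow> nat) \<Rightarrow> (nat \<Rightarrow> nat) \<Rightarrow>
   nat \<Rightarrow> nat \<Rightarrow> real poly" where
  "component_formula p q d \<rho> \<xi> m n j h =
     smult (kappa p q \<rho> \<xi> m n j) (V_poly p q d \<rho> \<xi> m n j h (int (m j) - 1) (d j - 1))
     - smult (kappa p q \<rho> \<xi> m n j * d j * xrow \<rho> j h / (d j + 1))
         (V_poly p q d \<rho> \<xi> m n j h (int (m j) - 2) (d j))
     - smult (d j)
         (\<Sum>J\<in>{1..q} - {j}.
            smult (kappa p q \<rho> \<xi> m n J * xrow \<rho> J j / (d J + 1))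
              (V_poly p q d \<rho> \<xi> m n J j (int (m J) - 2) (d J)))"


lemma length_rows_except:
  assumes "J \<in> {1..q}" "j \<in> {1..q}" "J \<noteq> j"
  shows "length (rows_except q {J}) = q - 1" "length (rows_except q {J, j}) = q - 2"
proof -
  have *: "length (rows_except q S) = card ({1..q} - S)" for S
  proof -
    have "distinct (rows_except q S)" by (simp add: rows_except_def)
    moreover have "set (rows_except q S) = {1..q} - S" by (auto simp: rows_except_def)
    ultimately show ?thesis using distinct_card by metis
  qed
  show "length (rows_except q {J}) = q - 1" "length (rows_except q {J, j}) = q - 2"
    unfolding * using assms by (simp_all add: card_Diff_subset)
qed

lemma length_V_args:
  assumes "J \<in> {1..q}" "j \<in> {1..q}" "J \<noteq> j"
  shows "length (V_args p q \<rho> \<xi> J j y) = p + 2 * q - 1"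
proof -
  have "length (V_args p q \<rho> \<xi> J j y) = p + (q - 1) + (q - 2) + 2"
    by (simp add: V_args_def length_rows_except[OF assms] del: upt_Suc)
  also have "\<dots> = p + 2 * q - 1" using assms by auto
  finally show ?thesis .
qed

lemma dot_vec_e:
  assumes "length k = p + 2 * q - 1" "q \<ge> 2"
  shows "dot (vec_e p q) k = sum_list k"
proof -
  have "vec_e p q = replicate (r0 p q + t0 q + 2) 1"
    unfolding vec_e_def replicate_add append_assoc by (simp add: numeral_2_eq_2)
  also have "r0 p q + t0 q + 2 = length k" using assms by (simp add: r0_def t0_def)
  finally have "vec_e p q = replicate (length k) 1" .
  moreover have "sum_list (map2 (*) (replicate (length k) 1) k) = sum_list k" for k :: "nat list"
    by (induction k) auto
  ultimately show ?thesis by (simp add: dot_def)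
qed

lemma sd_term_V_eq_0:
  assumes "J \<in> {1..q}" "j \<in> {1..q}" "J \<noteq> j"
    and "length k = p + 2 * q - 1" "sum_list k > N"
  shows "sd_term (V_upper p q d j N a) lo iup ilo z k = 0"
proof -
  have "q \<ge> 2" using assms by auto
  then show ?thesis using assms(4,5)
    by (simp add: sd_term_def V_upper_def dot_vec_e pochhammer_of_nat_eq_0_lemma)
qed

lemma finite_lists_sum_le: "finite {k :: nat list. length k = R \<and> sum_list k \<le> N}"
proof (rule finite_subset)
  show "{k :: nat list. length k = R \<and> sum_list k \<le> N} \<subseteq> {k. set k \<subseteq> {..N} \<and> length k = R}"
    using member_le_sum_list by fastforce
  show "finite {k :: nat list. set k \<subseteq> {..N} \<and> length k = R}"
    by (rule finite_lists_length_eq) simp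
qed

lemma V_sd_terminates:
  assumes "J \<in> {1..q}" "j \<in> {1..q}" "J \<noteq> j"
  shows "V_sd_terminating p q d \<rho> \<xi> m n J j N a y"
  unfolding V_sd_terminating_def sd_terminating_def length_V_args[OF assms]
proof (rule finite_subset[OF _ finite_lists_sum_le])
  show "{k. length k = p + 2 * q - 1 \<and>
          sd_term (V_upper p q d j N a) (V_lower p q d j a) (V_indiv p q d m n J j)
            (V_indiv_lower p q) (V_args p q \<rho> \<xi> J j y) k \<noteq> 0}
        \<subseteq> {k. length k = p + 2 * q - 1 \<and> sum_list k \<le> N}"
    using sd_term_V_eq_0[OF assms] by (auto simp: not_less[symmetric])
qed

lemma V_args_nth:
  assumes "J \<in> {1..q}" "j \<in> {1..q}" "J \<noteq> j"
  obtains w t where "\<And>\<nu>. t \<nu> \<le> (1::nat)"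
    and "\<And>\<nu> y. \<nu> < p + 2 * q - 1 \<Longrightarrow> V_args p q \<rho> \<xi> J j y ! \<nu> = w \<nu> * (1 / y) ^ t \<nu>"
proof -
  define fs where "fs =
     map (\<lambda>i y. - 1 / (ccol \<rho> \<xi> i J * y)) [1..<p+1] @
     map (\<lambda>h y. - xrow \<rho> J h / y) (rows_except q {J}) @
     map (\<lambda>h y. - xrow \<rho> J h / y) (rows_except q {J, j}) @
     [\<lambda>y. - xrow \<rho> J j / y, \<lambda>y. 1]"
  have args: "V_args p q \<rho> \<xi> J j y = map (\<lambda>f. f y) fs" for y
    by (simp add: V_args_def fs_def)
  have len: "length fs = p + 2 * q - 1"
    using length_V_args[OF assms, of p \<rho> \<xi> 1] by (simp add: args)
  have inv: "\<exists>w t. t \<le> (1::nat) \<and> (\<forall>y. f y = w * (1 / y) ^ t)" if "\<And>y. f y = w / y"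
    for f :: "real \<Rightarrow> real" and w
    using that by (intro exI[of _ w] exI[of _ 1]) simp
  have const: "\<exists>w t. t \<le> (1::nat) \<and> (\<forall>y. f y = w * (1 / y) ^ t)" if "f = (\<lambda>y. 1)"
    for f :: "real \<Rightarrow> real"
    using that by (intro exI[of _ 1] exI[of _ 0]) simp
  have "\<exists>w t. t \<le> (1::nat) \<and> (\<forall>y. f y = w * (1 / y) ^ t)" if f: "f \<in> set fs" for f
  proof -
    consider i where "f = (\<lambda>y. - 1 / (ccol \<rho> \<xi> i J * y))"
      | h where "f = (\<lambda>y. - xrow \<rho> J h / y)" | "f = (\<lambda>y. 1)"
      using f unfolding fs_def set_append set_map list.set by blast
    then show ?thesis
    proof cases
      case (1 i)
      show ?thesis by (rule inv[of f "- 1 / ccol \<rho> \<xi> i J"]) (simp add: 1)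
    next
      case (2 h)
      show ?thesis by (rule inv[of f "- xrow \<rho> J h"]) (simp add: 2)
    next
      case 3
      then show ?thesis by (rule const)
    qed
  qed
  then have each: "\<And>\<nu>. \<exists>w t. t \<le> (1::nat) \<and> (\<nu> < length fs \<longrightarrow> (\<forall>y. (fs ! \<nu>) y = w * (1 / y) ^ t))"
    by (metis nth_mem zero_le)
  obtain w t where wt: "\<forall>\<nu>. t \<nu> \<le> (1::nat) \<and>
      (\<nu> < length fs \<longrightarrow> (\<forall>y. (fs ! \<nu>) y = w \<nu> * (1 / y) ^ t \<nu>))"
    using choice[of "\<lambda>\<nu> wt. snd wt \<le> (1::nat) \<and>
      (\<nu> < length fs \<longrightarrow> (\<forall>y. (fs ! \<nu>) y = fst wt * (1 / y) ^ snd wt))"] each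
    by (metis fst_conv snd_conv)
  show thesis
    by (rule that[of t w]) (use wt in \<open>simp_all add: args len\<close>)
qed

lemma V_poly_exists:
  assumes "J \<in> {1..q}" "j \<in> {1..q}" "J \<noteq> j"
  shows "\<exists>P. degree P \<le> N \<and>
    (\<forall>y. y \<noteq> 0 \<longrightarrow> poly P y = y ^ N / fact N * V_sd p q d \<rho> \<xi> m n J j N a y)"
proof -
  define R where "R = p + 2 * q - 1"
  define K where "K = {k :: nat list. length k = R \<and> sum_list k \<le> N}"
  obtain w t where t: "\<And>\<nu>. t \<nu> \<le> (1::nat)"
    and w: "\<And>\<nu> y. \<nu> < R \<Longrightarrow> V_args p q \<rho> \<xi> J j y ! \<nu> = w \<nu> * (1 / y) ^ t \<nu>"
    using V_args_nth[OF assms] unfolding R_def by metis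
  define T where "T y = sd_term (V_upper p q d j N a) (V_lower p q d j a) (V_indiv p q d m n J j)
            (V_indiv_lower p q) (V_args p q \<rho> \<xi> J j y)" for y
  have finK: "finite K" unfolding K_def by (rule finite_lists_sum_le)
  have V: "V_sd p q d \<rho> \<xi> m n J j N a y = (\<Sum>k\<in>K. T y k)" for y
  proof -
    have "V_sd p q d \<rho> \<xi> m n J j N a y = (\<Sum>\<^sub>\<infinity>k\<in>{k. length k = R}. T y k)"
      by (simp add: V_sd_def srivastava_daoust_def length_V_args[OF assms] R_def T_def)
    also have "\<dots> = (\<Sum>\<^sub>\<infinity>k\<in>K. T y k)"
      by (rule infsum_cong_neutral)
        (auto simp: K_def T_def R_def not_le intro: sd_term_V_eq_0[OF assms])
    finally show ?thesis using finK by simp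
  qed
  have "\<exists>c e. e \<le> N \<and> (\<forall>y. T y k = c * (1 / y) ^ e)" if "k \<in> K" for k
  proof -
    define e where "e = (\<Sum>\<nu><R. t \<nu> * k ! \<nu>)"
    define A where "A = (\<Prod>(a, w)\<leftarrow>V_upper p q d j N a. pochhammer a (dot w k)) /
       (\<Prod>(a, w)\<leftarrow>V_lower p q d j a. pochhammer a (dot w k))"
    define C where "C \<nu> = (\<Prod>(b, w)\<leftarrow>V_indiv p q d m n J j ! \<nu>. pochhammer b (w * k ! \<nu>)) /
        (\<Prod>(b, w)\<leftarrow>V_indiv_lower p q ! \<nu>. pochhammer b (w * k ! \<nu>))" for \<nu>
    have "e \<le> (\<Sum>\<nu><R. k ! \<nu>)"
      unfolding e_def using t by (intro sum_mono) (metis mult_1 mult_le_mono1)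
    also have "\<dots> = sum_list k" using that by (simp add: K_def sum_list_sum_nth atLeast0LessThan)
    finally have "e \<le> N" using that by (simp add: K_def)
    moreover have "T y k = A * (\<Prod>\<nu><R. C \<nu> * (w \<nu> ^ (k ! \<nu>) / fact (k ! \<nu>))) * (1 / y) ^ e" for y
    proof -
      have "T y k = A * (\<Prod>\<nu><R. C \<nu> * ((V_args p q \<rho> \<xi> J j y ! \<nu>) ^ (k ! \<nu>) / fact (k ! \<nu>)))"
        by (simp add: T_def sd_term_def A_def C_def length_V_args[OF assms] R_def)
      also have "(\<Prod>\<nu><R. C \<nu> * ((V_args p q \<rho> \<xi> J j y ! \<nu>) ^ (k ! \<nu>) / fact (k ! \<nu>)))
        = (\<Prod>\<nu><R. C \<nu> * (w \<nu> ^ (k ! \<nu>) / fact (k ! \<nu>)) * (1 / y) ^ (t \<nu> * k ! \<nu>))"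
        by (intro prod.cong) (simp_all add: w power_mult_distrib power_mult)
      also have "\<dots> = (\<Prod>\<nu><R. C \<nu> * (w \<nu> ^ (k ! \<nu>) / fact (k ! \<nu>))) * (1 / y) ^ e"
        by (simp only: prod.distrib e_def power_sum)
      finally show ?thesis by (simp only: mult.assoc)
    qed
    ultimately show ?thesis by blast
  qed
  then obtain c e where ce: "\<And>k. k \<in> K \<Longrightarrow> e k \<le> N \<and> (\<forall>y. T y k = c k * (1 / y) ^ e k)"
    by metis
  let ?P = "\<Sum>k\<in>K. monom (c k / fact N) (N - e k)"
  have "degree ?P \<le> N"
    by (intro degree_sum_le finK) (meson degree_monom_le diff_le_self order_trans)
  moreover have "poly ?P y = y ^ N / fact N * V_sd p q d \<rho> \<xi> m n J j N a y" if "y \<noteq> 0" for y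
  proof -
    have "c k / fact N * y ^ (N - e k) = y ^ N / fact N * T y k" if "k \<in> K" for k
      using ce[OF that] \<open>y \<noteq> 0\<close> by (simp add: power_diff field_simps)
    then show ?thesis
      unfolding V by (simp add: poly_sum poly_monom sum_distrib_left)
  qed
  ultimately show ?thesis by blast
qed

lemma poly_eq_off_zero:
  fixes P Q :: "real poly"
  assumes "\<And>y. y \<noteq> 0 \<Longrightarrow> poly P y = poly Q y"
  shows "P = Q"
proof (rule poly_eqI_degree[where A = "real ` {1..max (degree P) (degree Q) + 1}"])
  show "card (real ` {1..max (degree P) (degree Q) + 1}) > degree P"
    and "card (real ` {1..max (degree P) (degree Q) + 1}) > degree Q"
    by (simp_all add: card_image)
qed (use assms in auto)

lemma V_poly_unique:
  assumes "\<And>y. y \<noteq> 0 \<Longrightarrow>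
    poly P y = y ^ N / fact N * V_sd p q d \<rho> \<xi> m n J j N a y"
  shows "V_poly p q d \<rho> \<xi> m n J j (int N) a = P"
proof -
  have "(THE P. \<forall>y. y \<noteq> 0 \<longrightarrow>
      poly P y = y ^ N / fact N * V_sd p q d \<rho> \<xi> m n J j N a y) = P"
  proof (rule the_equality)
    show "Q = P" if "\<forall>y. y \<noteq> 0 \<longrightarrow>
      poly Q y = y ^ N / fact N * V_sd p q d \<rho> \<xi> m n J j N a y" for Q
      using that assms by (intro poly_eq_off_zero) simp
  qed (use assms in blast)
  then show ?thesis unfolding V_poly_def by simp
qed

lemma poly_V_poly:
  assumes "J \<in> {1..q}" "j \<in> {1..q}" "J \<noteq> j"
  shows "degree (V_poly p q d \<rho> \<xi> m n J j (int N) a) \<le> N"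
    and "y \<noteq> 0 \<Longrightarrow> poly (V_poly p q d \<rho> \<xi> m n J j (int N) a) y =
           y ^ N / fact N * V_sd p q d \<rho> \<xi> m n J j N a y"
proof -
  obtain P where P: "degree P \<le> N" "\<And>y. y \<noteq> 0 \<Longrightarrow>
      poly P y = y ^ N / fact N * V_sd p q d \<rho> \<xi> m n J j N a y"
    using V_poly_exists[OF assms] by blast
  then have "V_poly p q d \<rho> \<xi> m n J j (int N) a = P"
    by (intro V_poly_unique)
  with P show "degree (V_poly p q d \<rho> \<xi> m n J j (int N) a) \<le> N"
    and "y \<noteq> 0 \<Longrightarrow> poly (V_poly p q d \<rho> \<xi> m n J j (int N) a) y =
           y ^ N / fact N * V_sd p q d \<rho> \<xi> m n J j N a y"
    by simp_all
qed

end

theory Submission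
  imports Defs "HOL-Computational_Algebra.Formal_Power_Series"
    "HOL-Computational_Algebra.Polynomial_FPS"
begin

text \<open>The Laplace transform of \<open>y ^ k * F i\<close> is \<open>\<Phi> * D ^ k (1 / (z + \<rho> i))\<close>, where
  \<open>\<Phi> = (\<Prod>h. (z + \<rho> h) powr (- d h))\<close> and \<open>D f = - f' + (\<Sum>h. d h / (z + \<rho> h)) * f\<close>, so the
  normalization is an identity between rational functions with poles in the points \<open>- \<rho> h\<close>. For fixed
  \<open>y\<close> and \<open>j\<close> there is a linear functional on such functions that turns \<open>D\<close> into multiplication by
  \<open>y\<close> and maps \<open>1 / (z + \<rho> i)\<close> to \<open>1\<close> if \<open>i = j\<close> and to \<open>0\<close> otherwise: it sums the residues
  against power series \<open>K J\<close> at \<open>- \<rho> J\<close> that solve the equation adjoint to \<open>D\<close>. Applied to the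
  normalization it yields the value of \<open>B j\<close> at \<open>y\<close> as a sum over \<open>J\<close> of coefficients of explicit
  power series, and the Srivastava--Daoust sums are such coefficients too.\<close>

section \<open>Laplace transforms of the row weights\<close>

definition has_laplace :: "real \<Rightarrow> (real \<Rightarrow> real) \<Rightarrow> (real \<Rightarrow> real) \<Rightarrow> bool" where
  "has_laplace z0 f \<phi> \<longleftrightarrow>
     f \<in> borel_measurable borel \<and> (\<forall>y. 0 \<le> f y) \<and> (\<forall>y<0. f y = 0) \<and>
     (\<forall>z>z0. 0 \<le> \<phi> z \<and> (\<integral>\<^sup>+y. ennreal (exp (- z * y) * f y) \<partial>lborel) = ennreal (\<phi> z))"

lemma gamma_density_measurable [measurable]: "gamma_density \<rho> d \<in> borel_measurable borel"
  unfolding gamma_density_def[abs_def] by measurable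

lemma has_laplace_gamma_density:
  assumes d: "d > 0" and z0: "- \<rho> \<le> z0"
  shows "has_laplace z0 (gamma_density \<rho> d) (\<lambda>z. (z + \<rho>) powr (- d))"
proof -
  have G: "Gamma d > 0" using d by (rule Gamma_real_pos)
  have "(\<integral>\<^sup>+y. ennreal (exp (- z * y) * gamma_density \<rho> d y) \<partial>lborel) = ennreal ((z + \<rho>) powr (- d))"
    if z: "z > z0" for z
  proof -
    define c where "c = z + \<rho>"
    have c: "c > 0" using z z0 by (simp add: c_def)
    define k where "k t = indicator {0::real..} t * (t powr (d - 1) / exp t)" for t
    have k [measurable]: "k \<in> borel_measurable borel" unfolding k_def[abs_def] by measurable
    have "ennreal (Gamma d) = (\<integral>\<^sup>+t. ennreal (k t) \<partial>lborel)"
      using nn_integral_has_integral_lebesgue[OF _ Gamma_integral_real[OF d]]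
      by (simp add: k_def)
    also have "\<dots> = \<bar>c\<bar> * (\<integral>\<^sup>+y. ennreal (k (0 + c * y)) \<partial>lborel)"
      by (rule nn_integral_real_affine) (use c in auto)
    also have "(\<integral>\<^sup>+y. ennreal (k (0 + c * y)) \<partial>lborel)
        = (\<integral>\<^sup>+y. ennreal (c powr (d - 1) * Gamma d) *
              ennreal (exp (- z * y) * gamma_density \<rho> d y) \<partial>lborel)"
    proof (rule nn_integral_cong)
      fix y :: real
      have "k (0 + c * y) = c powr (d - 1) * Gamma d * (exp (- z * y) * gamma_density \<rho> d y)"
      proof (cases "y > 0")
        case True
        then have "exp (- z * y) * exp (- \<rho> * y) = 1 / exp (c * y)"
          by (simp add: exp_add[symmetric] exp_minus[symmetric] c_def inverse_eq_divide[symmetric]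
            algebra_simps)
        with True c G show ?thesis
          by (simp add: k_def gamma_density_def powr_mult mult_ac field_simps)
      next
        case False
        then show ?thesis using c
          by (cases "y = 0") (auto simp: k_def gamma_density_def indicator_def zero_le_mult_iff)
      qed
      then show "ennreal (k (0 + c * y)) = ennreal (c powr (d - 1) * Gamma d) *
              ennreal (exp (- z * y) * gamma_density \<rho> d y)"
        using G by (simp add: ennreal_mult'[symmetric])
    qed
    also have "\<dots> = ennreal (c powr (d - 1) * Gamma d) *
        (\<integral>\<^sup>+y. ennreal (exp (- z * y) * gamma_density \<rho> d y) \<partial>lborel)" (is "_ = _ * ?I")
      by (rule nn_integral_cmult) measurable
    finally have *: "ennreal (Gamma d) = ennreal (c * (c powr (d - 1) * Gamma d)) * ?I"
      using c G by (simp add: ennreal_mult' mult.assoc)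
    have cd: "c * (c powr (d - 1) * Gamma d) = c powr d * Gamma d"
      using c by (simp add: powr_diff)
    \<comment> \<open>The integral is not yet known to be finite, so it is isolated by multiplying
      with a finite positive constant instead of dividing.\<close>
    have "?I = ennreal (c powr (- d) / Gamma d) * (ennreal (c powr d * Gamma d) * ?I)"
      using c G by (simp add: mult.assoc[symmetric] ennreal_mult'[symmetric] powr_minus)
    also have "\<dots> = ennreal (c powr (- d) / Gamma d) * ennreal (Gamma d)"
      by (subst *) (simp add: cd)
    also have "\<dots> = ennreal (c powr (- d))"
      using G by (simp add: ennreal_mult'[symmetric])
    finally show ?thesis by (simp add: c_def)
  qed
  then show ?thesis
    using d by (auto simp: has_laplace_def gamma_density_def Gamma_real_nonneg)
qed

text \<open>Tonelli's theorem and a translation of the inner variable. Nonnegative extended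
  integrals allow the exchange before any integrability is known, and the condition
  \<open>0 \<le> \<phi> z\<close> in \<open>has_laplace\<close> makes
  \<open>ennreal (\<phi> z)\<close> lose no information.\<close>

lemma has_laplace_conv_pos:
  assumes f: "has_laplace z0 f \<phi>" and g: "has_laplace z0 g \<psi>"
  shows "has_laplace z0 (conv_pos f g) (\<lambda>z. \<phi> z * \<psi> z)"
proof -
  have [measurable]: "f \<in> borel_measurable borel" "g \<in> borel_measurable borel"
    and f0: "\<And>y. 0 \<le> f y" and g0: "\<And>y. 0 \<le> g y"
    and fn: "\<And>y. y < 0 \<Longrightarrow> f y = 0" and gn: "\<And>y. y < 0 \<Longrightarrow> g y = 0"
    using f g by (auto simp: has_laplace_def)
  have conv: "conv_pos f g y = (\<integral>u. f u * g (y - u) \<partial>lborel)" for y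
    unfolding conv_pos_def set_lebesgue_integral_def
  proof (rule Bochner_Integration.integral_cong)
    show "indicat_real {0..y} u *\<^sub>R (f u * g (y - u)) = f u * g (y - u)" for u
      using fn[of u] gn[of "y - u"] by (cases "u < 0"; cases "u > y") (auto simp: indicator_def)
  qed simp
  have meas [measurable]: "conv_pos f g \<in> borel_measurable borel"
    unfolding conv[abs_def] by measurable
  have nonneg: "0 \<le> conv_pos f g y" for y
    unfolding conv by (intro integral_nonneg_AE) (simp add: f0 g0)
  have "conv_pos f g y = 0" if "y < 0" for y
  proof -
    have "f u * g (y - u) = 0" for u
      using that fn[of u] gn[of "y - u"] by (cases "u < 0") auto
    then have "(\<lambda>u. f u * g (y - u)) = (\<lambda>u. 0)" by blast
    then show ?thesis unfolding conv by simp
  qed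
  moreover have "(\<integral>\<^sup>+y. ennreal (exp (- z * y) * conv_pos f g y) \<partial>lborel) = ennreal (\<phi> z * \<psi> z)"
    if z: "z > z0" for z
  proof -
    have F: "(\<integral>\<^sup>+y. ennreal (exp (- z * y) * f y) \<partial>lborel) = ennreal (\<phi> z)"
      and G: "(\<integral>\<^sup>+y. ennreal (exp (- z * y) * g y) \<partial>lborel) = ennreal (\<psi> z)"
      and p0: "0 \<le> \<phi> z"
      using f g z by (auto simp: has_laplace_def)
    define I where "I y = (\<integral>\<^sup>+u. ennreal (f u * g (y - u)) \<partial>lborel)" for y
    have [measurable]: "I \<in> borel_measurable borel"
      unfolding I_def[abs_def] by measurable
    have "(\<integral>\<^sup>+y. ennreal (exp (- z * y)) * I y \<partial>lborel)
       = (\<integral>\<^sup>+y. \<integral>\<^sup>+u. ennreal (exp (- z * y) * (f u * g (y - u))) \<partial>lborel \<partial>lborel)"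
      by (simp add: I_def nn_integral_cmult[symmetric] ennreal_mult'[symmetric])
    also have "\<dots> = (\<integral>\<^sup>+u. \<integral>\<^sup>+y. ennreal (exp (- z * y) * (f u * g (y - u))) \<partial>lborel \<partial>lborel)"
      by (rule lborel_pair.Fubini') measurable
    also have "\<dots> = (\<integral>\<^sup>+u. ennreal (exp (- z * u) * f u) * ennreal (\<psi> z) \<partial>lborel)"
    proof (rule nn_integral_cong)
      fix u :: real
      have "(\<integral>\<^sup>+y. ennreal (exp (- z * y) * (f u * g (y - u))) \<partial>lborel)
        = \<bar>1::real\<bar> * (\<integral>\<^sup>+y. ennreal (exp (- z * (u + 1 * y)) * (f u * g ((u + 1 * y) - u))) \<partial>lborel)"
        by (rule nn_integral_real_affine) auto
      also have "\<dots> = (\<integral>\<^sup>+y. ennreal (exp (- z * u) * f u) * ennreal (exp (- z * y) * g y) \<partial>lborel)"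
        by (simp add: ennreal_mult'[symmetric] f0 exp_add[symmetric] algebra_simps flip: mult.assoc)
      also have "\<dots> = ennreal (exp (- z * u) * f u) * ennreal (\<psi> z)"
        by (subst nn_integral_cmult) (simp_all only: G, measurable)
      finally show "(\<integral>\<^sup>+y. ennreal (exp (- z * y) * (f u * g (y - u))) \<partial>lborel)
        = ennreal (exp (- z * u) * f u) * ennreal (\<psi> z)" .
    qed
    also have "\<dots> = ennreal (\<phi> z * \<psi> z)"
      by (subst nn_integral_multc) (simp_all only: F ennreal_mult'[symmetric, OF p0], measurable)
    finally have E: "(\<integral>\<^sup>+y. ennreal (exp (- z * y)) * I y \<partial>lborel) = ennreal (\<phi> z * \<psi> z)" .
    \<comment> \<open>The Bochner integral in \<open>conv_pos\<close> is 0 by default where the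
      convolution integral diverges. Finiteness of the double integral confines this to a null set,
      off which \<open>conv_pos\<close> agrees with \<open>I\<close>.\<close>
    have "AE y in lborel. ennreal (exp (- z * y)) * I y \<noteq> \<infinity>"
    proof (rule nn_integral_PInf_AE)
      show "(\<integral>\<^sup>+y. ennreal (exp (- z * y)) * I y \<partial>lborel) \<noteq> \<infinity>" unfolding E by simp
    qed measurable
    then have "AE y in lborel. ennreal (exp (- z * y) * conv_pos f g y) = ennreal (exp (- z * y)) * I y"
    proof eventually_elim
      case (elim y)
      then have fin: "I y < \<infinity>"
        by (auto simp: ennreal_mult_eq_top_iff less_top)
      have "integrable lborel (\<lambda>u. f u * g (y - u))"
        by (rule integrableI_nonneg) (use fin in \<open>auto simp: I_def f0 g0\<close>)
      then have "I y = ennreal (conv_pos f g y)"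
        unfolding I_def conv by (intro nn_integral_eq_integral) (auto simp: f0 g0)
      then show ?case by (simp add: ennreal_mult')
    qed
    from nn_integral_cong_AE[OF this] show ?thesis unfolding E .
  qed
  ultimately show ?thesis
    using f g nonneg by (simp add: has_laplace_def)
qed

lemma has_laplace_integrable:
  assumes "has_laplace z0 f \<phi>" "z > z0"
  shows "integrable lborel (\<lambda>y. exp (- z * y) * f y)"
    and "(\<integral>y. exp (- z * y) * f y \<partial>lborel) = \<phi> z"
proof -
  have [measurable]: "f \<in> borel_measurable borel"
    and f0: "\<And>y. 0 \<le> f y" and p0: "0 \<le> \<phi> z"
    and I: "(\<integral>\<^sup>+y. ennreal (exp (- z * y) * f y) \<partial>lborel) = ennreal (\<phi> z)"
    using assms by (auto simp: has_laplace_def)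
  show int: "integrable lborel (\<lambda>y. exp (- z * y) * f y)"
    using I by (intro integrableI_nonneg) (auto simp: f0)
  show "(\<integral>y. exp (- z * y) * f y \<partial>lborel) = \<phi> z"
    using nn_integral_eq_integral[OF int] p0 I
    by (simp add: f0 integral_nonneg_AE)
qed

section \<open>Differentiation under the Laplace integral\<close>

lemma abs_exp_minus_one_le: "\<bar>exp x - 1\<bar> \<le> \<bar>x\<bar> * exp \<bar>x\<bar>" for x :: real
proof (cases "x \<ge> 0")
  case True
  have "exp x - 1 = exp x * (1 - exp (- x))" by (simp add: algebra_simps exp_minus)
  also have "\<dots> \<le> exp x * x" using exp_ge_add_one_self[of "- x"] by (intro mult_left_mono) auto
  finally show ?thesis using True by (simp add: mult.commute)
next
  case False
  have "1 - exp x \<le> \<bar>x\<bar> * 1" using exp_ge_add_one_self[of x] False by linarith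
  also have "\<dots> \<le> \<bar>x\<bar> * exp \<bar>x\<bar>" by (intro mult_left_mono) auto
  finally show ?thesis using False by simp
qed

text \<open>Dominated convergence for the difference quotients. Half of the distance from z to z0 is
  given up: a step of size below \<open>e / 2\<close> costs a factor exp (e/2 * y), and the
  remaining \<open>e / 2\<close> pays for the factor y that differentiation brings down. This yields
  the majorant \<open>w\<close>.\<close>

lemma laplace_integral_deriv:
  fixes f :: "real \<Rightarrow> real"
  assumes meas [measurable]: "f \<in> borel_measurable borel" and supp: "\<And>y. y < 0 \<Longrightarrow> f y = 0"
    and int: "\<And>z. z > z0 \<Longrightarrow> integrable lborel (\<lambda>y. exp (- z * y) * f y)" and z: "z > z0"
  shows "integrable lborel (\<lambda>y. exp (- z * y) * (y * f y))"
    and "((\<lambda>z. \<integral>y. exp (- z * y) * f y \<partial>lborel) has_field_derivative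
           - (\<integral>y. exp (- z * y) * (y * f y) \<partial>lborel)) (at z)"
proof -
  define e where "e = (z - z0) / 2"
  have e: "e > 0" "z - e > z0" using z by (auto simp: e_def field_simps)
  define w where "w y = 2 / e * \<bar>exp (- (z - e) * y) * f y\<bar>" for y
  have w: "integrable lborel w"
    unfolding w_def[abs_def] using int[OF e(2)] by (intro integrable_mult_right integrable_abs)
  have lin: "y * exp (- (z - e / 2) * y) \<le> 2 / e * exp (- (z - e) * y)" if "y \<ge> 0" for y
  proof -
    have "e / 2 * y \<le> exp (e / 2 * y)" using exp_ge_add_one_self[of "e / 2 * y"] by linarith
    then have "y \<le> 2 / e * exp (e / 2 * y)" using e by (simp add: field_simps)
    then have "y * exp (- (z - e / 2) * y) \<le> 2 / e * exp (e / 2 * y) * exp (- (z - e / 2) * y)"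
      by (intro mult_right_mono) auto
    also have "\<dots> = 2 / e * exp (- (z - e) * y)"
      by (simp add: mult.assoc exp_add[symmetric]) (simp add: algebra_simps)
    finally show ?thesis .
  qed
  have bnd: "\<bar>(exp (- (z + h) * y) * f y - exp (- z * y) * f y) / h\<bar> \<le> w y"
    if h: "h \<noteq> 0" "\<bar>h\<bar> < e / 2" for h y
  proof (cases "y < 0")
    case True then show ?thesis by (simp add: supp w_def)
  next
    case False
    then have y: "y \<ge> 0" by simp
    have "exp (- (z + h) * y) * f y - exp (- z * y) * f y = exp (- z * y) * (exp (- h * y) - 1) * f y"
      by (simp add: algebra_simps exp_add[symmetric])
    then have "\<bar>(exp (- (z + h) * y) * f y - exp (- z * y) * f y) / h\<bar>
      = exp (- z * y) * (\<bar>exp (- h * y) - 1\<bar> / \<bar>h\<bar>) * \<bar>f y\<bar>"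
      by (simp add: abs_mult)
    also have "\<dots> \<le> exp (- z * y) * (y * exp (e / 2 * y)) * \<bar>f y\<bar>"
    proof (intro mult_right_mono mult_left_mono)
      have "\<bar>exp (- h * y) - 1\<bar> \<le> \<bar>h\<bar> * y * exp (\<bar>h\<bar> * y)"
        using abs_exp_minus_one_le[of "- h * y"] y by (simp add: abs_mult)
      also have "\<dots> \<le> \<bar>h\<bar> * y * exp (e / 2 * y)"
        using h y mult_right_mono[of "\<bar>h\<bar>" "e / 2" y] by (intro mult_left_mono) auto
      finally show "\<bar>exp (- h * y) - 1\<bar> / \<bar>h\<bar> \<le> y * exp (e / 2 * y)"
        using h by (simp add: field_simps)
    qed auto
    also have "exp (- z * y) * (y * exp (e / 2 * y)) = y * exp (- (z - e / 2) * y)"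
      by (simp add: algebra_simps exp_add[symmetric])
    also have "y * exp (- (z - e / 2) * y) * \<bar>f y\<bar> \<le> 2 / e * exp (- (z - e) * y) * \<bar>f y\<bar>"
      by (intro mult_right_mono lin y) auto
    also have "\<dots> = w y" by (simp add: w_def abs_mult)
    finally show ?thesis .
  qed
  show i2: "integrable lborel (\<lambda>y. exp (- z * y) * (y * f y))"
  proof (rule Bochner_Integration.integrable_bound[OF w])
    show "AE y in lborel. norm (exp (- z * y) * (y * f y)) \<le> norm (w y)"
    proof (rule AE_I2)
      fix y show "norm (exp (- z * y) * (y * f y)) \<le> norm (w y)"
      proof (cases "y < 0")
        case False
        then have y: "y \<ge> 0" by simp
        have "exp (- z * y) \<le> exp (- (z - e / 2) * y)" using e y by (simp add: algebra_simps)
        then have "y * exp (- z * y) \<le> 2 / e * exp (- (z - e) * y)"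
          using lin[OF y] y by (meson mult_left_mono order_trans)
        then have "y * exp (- z * y) * \<bar>f y\<bar> \<le> 2 / e * exp (- (z - e) * y) * \<bar>f y\<bar>"
          by (rule mult_right_mono) auto
        then show ?thesis using y e by (simp add: w_def abs_mult mult_ac)
      qed (simp add: supp)
    qed
  qed simp
  have "((\<lambda>h. ((\<integral>y. exp (- (z + h) * y) * f y \<partial>lborel) - (\<integral>y. exp (- z * y) * f y \<partial>lborel)) / h)
      \<longlongrightarrow> - (\<integral>y. exp (- z * y) * (y * f y) \<partial>lborel)) (at 0)"
    unfolding tendsto_at_iff_sequentially
  proof (intro allI impI)
    fix X :: "nat \<Rightarrow> real"
    assume X: "\<forall>i. X i \<in> UNIV - {0}" "X \<longlonglongrightarrow> 0"
    have "eventually (\<lambda>i. \<bar>X i\<bar> < e / 2) sequentially"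
      using tendstoD[OF X(2), of "e / 2"] e by (simp add: dist_real_def)
    then obtain N where N: "\<And>i. i \<ge> N \<Longrightarrow> \<bar>X i\<bar> < e / 2" by (auto simp: eventually_sequentially)
    have X0: "X i \<noteq> 0" for i using X by simp
    \<comment> \<open>The shift by \<open>N\<close> makes every step smaller than
      \<open>e / 2\<close>, as the majorant requires.\<close>
    define s where "s i y = (exp (- (z + X (i + N)) * y) * f y - exp (- z * y) * f y) / X (i + N)" for i y
    have "(\<lambda>i. \<integral>y. s i y \<partial>lborel) \<longlonglongrightarrow> (\<integral>y. - (exp (- z * y) * (y * f y)) \<partial>lborel)"
    proof (rule integral_dominated_convergence[OF _ _ w])
      show "AE y in lborel. norm (s i y) \<le> w y" for i
        unfolding s_def using bnd[OF X0 N[of "i + N"]] by auto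
      show "AE y in lborel. (\<lambda>i. s i y) \<longlonglongrightarrow> - (exp (- z * y) * (y * f y))"
      proof (rule AE_I2)
        fix y
        have "((\<lambda>x. exp (- x * y) * f y) has_field_derivative - (exp (- z * y) * (y * f y))) (at z)"
          by (auto intro!: derivative_eq_intros)
        then have "((\<lambda>h. (exp (- (z + h) * y) * f y - exp (- z * y) * f y) / h)
          \<longlongrightarrow> - (exp (- z * y) * (y * f y))) (at 0)"
          unfolding DERIV_def .
        then have "(\<lambda>i. (exp (- (z + X i) * y) * f y - exp (- z * y) * f y) / X i)
          \<longlonglongrightarrow> - (exp (- z * y) * (y * f y))"
          using X unfolding tendsto_at_iff_sequentially comp_def by blast
        then show "(\<lambda>i. s i y) \<longlonglongrightarrow> - (exp (- z * y) * (y * f y))"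
          unfolding s_def by (rule LIMSEQ_ignore_initial_segment)
      qed
    qed (auto simp: s_def[abs_def])
    moreover have "(\<integral>y. s i y \<partial>lborel) = ((\<integral>y. exp (- (z + X (i + N)) * y) * f y \<partial>lborel)
         - (\<integral>y. exp (- z * y) * f y \<partial>lborel)) / X (i + N)" for i
    proof -
      have "z + X (i + N) > z0" using N[of "i + N"] e by (auto simp: abs_less_iff e_def field_simps)
      then show ?thesis
        unfolding s_def integral_divide_zero
        by (subst Bochner_Integration.integral_diff)
          (use int[of "z + X (i + N)"] int[OF z] in auto)
    qed
    ultimately have "(\<lambda>i. ((\<integral>y. exp (- (z + X (i + N)) * y) * f y \<partial>lborel)
         - (\<integral>y. exp (- z * y) * f y \<partial>lborel)) / X (i + N))
       \<longlonglongrightarrow> - (\<integral>y. exp (- z * y) * (y * f y) \<partial>lborel)"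
      by simp
    then show "((\<lambda>h. ((\<integral>y. exp (- (z + h) * y) * f y \<partial>lborel) - (\<integral>y. exp (- z * y) * f y \<partial>lborel)) / h)
        \<circ> X) \<longlonglongrightarrow> - (\<integral>y. exp (- z * y) * (y * f y) \<partial>lborel)"
      unfolding comp_def by (rule LIMSEQ_offset)
  qed
  then show "((\<lambda>z. \<integral>y. exp (- z * y) * f y \<partial>lborel) has_field_derivative
           - (\<integral>y. exp (- z * y) * (y * f y) \<partial>lborel)) (at z)"
    unfolding DERIV_def .
qed

section \<open>Transforms of the row weights and of their moments\<close>

lemma has_laplace_foldl:
  assumes "\<And>i. i \<in> set is \<Longrightarrow> has_laplace z0 (g i) (\<phi> i)" and "has_laplace z0 f \<psi>"
  shows "has_laplace z0 (foldl conv_pos f (map g is)) (\<lambda>z. \<psi> z * (\<Prod>i\<leftarrow>is. \<phi> i z))"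
  using assms
proof (induction "is" arbitrary: f \<psi>)
  case (Cons i "is")
  have "has_laplace z0 (foldl conv_pos (conv_pos f (g i)) (map g is))
     (\<lambda>z. (\<psi> z * \<phi> i z) * (\<Prod>i\<leftarrow>is. \<phi> i z))"
    using Cons.prems by (intro Cons.IH has_laplace_conv_pos) auto
  then show ?case by (simp add: mult.assoc)
qed simp

lemma has_laplace_row_weight:
  assumes q: "q \<ge> 1" and d: "\<forall>h\<in>{1..q}. d h > 0" and z0: "\<forall>h\<in>{1..q}. - \<rho> h \<le> z0" and j: "j \<in> {1..q}"
  shows "has_laplace z0 (row_weight q d \<rho> j) (\<lambda>z. (\<Prod>h=1..q. (z + \<rho> h) powr (- d h)) / (z + \<rho> j))"
proof -
  define g where "g h = gamma_density (\<rho> h) (d h + (if h = j then 1 else 0))" for h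
  define \<phi> where "\<phi> h z = (z + \<rho> h) powr (- (d h + (if h = j then 1 else 0)))" for h z
  have lap: "has_laplace z0 (g h) (\<phi> h)" if "h \<in> {1..q}" for h
    unfolding g_def \<phi>_def using that d z0 
    by (intro has_laplace_gamma_density) (auto intro: add_pos_pos)
  have split: "[1..<q+1] = 1 # [2..<q+1]" using q by (simp add: upt_conv_Cons numeral_2_eq_2)
  have "row_weight q d \<rho> j = foldl conv_pos (g 1) (map g [2..<q+1])"
    unfolding row_weight_def Let_def g_def[symmetric] split by simp
  moreover have "has_laplace z0 (foldl conv_pos (g 1) (map g [2..<q+1]))
      (\<lambda>z. \<phi> 1 z * (\<Prod>h\<leftarrow>[2..<q+1]. \<phi> h z))"
    by (rule has_laplace_foldl) (use q in \<open>auto intro!: lap\<close>)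
  moreover have "\<phi> 1 z * (\<Prod>h\<leftarrow>[2..<q+1]. \<phi> h z) =
      (\<Prod>h=1..q. (z + \<rho> h) powr (- d h)) / (z + \<rho> j)" if z: "z > z0" for z
  proof -
    have "\<phi> 1 z * (\<Prod>h\<leftarrow>[2..<q+1]. \<phi> h z) = (\<Prod>h\<leftarrow>[1..<q+1]. \<phi> h z)" unfolding split by simp
    also have "\<dots> = (\<Prod>h=1..q. \<phi> h z)"
      by (subst prod.distinct_set_conv_list[symmetric])
        (simp_all add: atLeastLessThanSuc_atLeastAtMost del: upt_Suc)
    also have "\<dots> = (\<Prod>h=1..q. (z + \<rho> h) powr (- d h) * (if h = j then 1 / (z + \<rho> h) else 1))"
    proof (rule prod.cong)
      fix h assume h: "h \<in> {1..q}"
      have "z + \<rho> h > 0" using z z0 h by force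
      then show "\<phi> h z = (z + \<rho> h) powr (- d h) * (if h = j then 1 / (z + \<rho> h) else 1)"
        using powr_diff[of "z + \<rho> h" "- d h" 1] by (auto simp: \<phi>_def)
    qed simp
    also have "\<dots> = (\<Prod>h=1..q. (z + \<rho> h) powr (- d h)) / (z + \<rho> j)"
      using j by (simp add: prod.distrib)
    finally show ?thesis .
  qed
  ultimately show ?thesis by (simp add: has_laplace_def)
qed

lemma row_weight_moment_deriv:
  assumes q: "q \<ge> 1" and d: "\<forall>h\<in>{1..q}. d h > 0" and z0: "\<forall>h\<in>{1..q}. - \<rho> h \<le> z0" and j: "j \<in> {1..q}"
    and z: "z > z0"
  shows "integrable lborel (\<lambda>y. exp (- z * y) * (y ^ k * row_weight q d \<rho> j y))"
    and "((\<lambda>z. \<integral>y. exp (- z * y) * (y ^ k * row_weight q d \<rho> j y) \<partial>lborel) has_field_derivative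
           - (\<integral>y. exp (- z * y) * (y ^ Suc k * row_weight q d \<rho> j y) \<partial>lborel)) (at z)"
proof -
  note lap = has_laplace_row_weight[OF q d z0 j]
  have [measurable]: "row_weight q d \<rho> j \<in> borel_measurable borel"
    and supp: "\<And>y. y < 0 \<Longrightarrow> row_weight q d \<rho> j y = 0"
    using lap by (auto simp: has_laplace_def)
  have int: "z > z0 \<Longrightarrow> integrable lborel (\<lambda>y. exp (- z * y) * (y ^ k * row_weight q d \<rho> j y))" for z k
  proof (induction k arbitrary: z)
    case 0
    then show ?case using has_laplace_integrable(1)[OF lap] by simp
  next
    case (Suc k)
    show ?case
      using laplace_integral_deriv(1)[OF _ _ Suc.IH Suc.prems] supp by (simp add: mult.assoc)
  qed
  then show "integrable lborel (\<lambda>y. exp (- z * y) * (y ^ k * row_weight q d \<rho> j y))" using z by simp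
  show "((\<lambda>z. \<integral>y. exp (- z * y) * (y ^ k * row_weight q d \<rho> j y) \<partial>lborel) has_field_derivative
           - (\<integral>y. exp (- z * y) * (y ^ Suc k * row_weight q d \<rho> j y) \<partial>lborel)) (at z)"
    using laplace_integral_deriv(2)[OF _ _ int z] supp by (simp add: mult.assoc)
qed

section \<open>Binomial series and the residue kernels\<close>

unbundle no vec_syntax and fps_syntax

text \<open>The binomial series (1 - x X)^(-a). The sign of the exponent makes its coefficients the
  factors that an individual upper parameter contributes to a hypergeometric term.\<close>

definition binom_fps :: "real \<Rightarrow> real \<Rightarrow> real fps" where
  "binom_fps x a = Abs_fps (\<lambda>n. pochhammer a n / fact n * x ^ n)"

lemma binom_fps_nth [simp]: "binom_fps x a $ n = pochhammer a n / fact n * x ^ n"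
  by (simp add: binom_fps_def)

text \<open>In coefficient form the equation is a first-order recurrence, so together with constant
  coefficient 1 it characterizes the series. The power laws below are checked through the equation
  and need no convolution identity for Pochhammer symbols.\<close>

lemma binom_fps_ode_iff:
  "(1 - fps_const x * fps_X) * fps_deriv f = fps_const (a * x) * f \<longleftrightarrow>
   (\<forall>n. of_nat (Suc n) * f $ Suc n = x * (a + of_nat n) * f $ n)" for f :: "real fps"
proof -
  have *: "((1 - fps_const x * fps_X) * fps_deriv f) $ n =
      of_nat (Suc n) * f $ Suc n - x * of_nat n * f $ n" for n
    by (cases n) (simp_all add: left_diff_distrib mult.assoc)
  show ?thesis
    unfolding fps_eq_iff * by (intro all_cong1) (auto simp: algebra_simps)
qed

lemma binom_fps_ode: "(1 - fps_const x * fps_X) * fps_deriv (binom_fps x a) = fps_const (a * x) * binom_fps x a"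
proof -
  have "c * (P * u / (c * F) * (x * X)) = x * u * (P / F * X)" if "c \<noteq> 0" for c P u F X :: real
    using that by (cases "F = 0") (simp_all add: field_simps)
  then show ?thesis
    unfolding binom_fps_ode_iff by (simp add: pochhammer_Suc del: of_nat_Suc)
qed

lemma binom_fps_eqI:
  assumes "(1 - fps_const x * fps_X) * fps_deriv f = fps_const (a * x) * f" "f $ 0 = 1"
  shows "f = binom_fps x a"
proof (rule fps_ext)
  fix n show "f $ n = binom_fps x a $ n"
  proof (induction n)
    case (Suc n)
    have "real (Suc n) * f $ Suc n = x * (a + real n) * f $ n"
      using assms(1) unfolding binom_fps_ode_iff by blast
    also have "\<dots> = real (Suc n) * binom_fps x a $ Suc n"
      unfolding Suc using binom_fps_ode[of x a] unfolding binom_fps_ode_iff by metis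
    finally show ?case by (simp only: mult_cancel_left of_nat_eq_0_iff nat.distinct simp_thms)
  qed (use assms in simp)
qed

lemma binom_fps_add: "binom_fps x (a + b) = binom_fps x a * binom_fps x b"
proof (rule binom_fps_eqI[symmetric])
  have "(1 - fps_const x * fps_X) * fps_deriv (binom_fps x a * binom_fps x b) =
     binom_fps x a * ((1 - fps_const x * fps_X) * fps_deriv (binom_fps x b))
     + ((1 - fps_const x * fps_X) * fps_deriv (binom_fps x a)) * binom_fps x b"
    by (simp add: algebra_simps)
  also have "\<dots> = (fps_const (a * x) + fps_const (b * x)) * (binom_fps x a * binom_fps x b)"
    unfolding binom_fps_ode by (simp only: distrib_left distrib_right mult_ac add_ac)
  also have "fps_const (a * x) + fps_const (b * x) = fps_const ((a + b) * x)"
    by (simp add: distrib_right)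
  finally show "(1 - fps_const x * fps_X) * fps_deriv (binom_fps x a * binom_fps x b) =
    fps_const ((a + b) * x) * (binom_fps x a * binom_fps x b)" .
qed simp

lemma binom_fps_0 [simp]: "binom_fps x 0 = 1"
  by (rule binom_fps_eqI[symmetric]) auto

lemma binom_fps_minus_one: "binom_fps x (- 1) = 1 - fps_const x * fps_X"
  by (rule binom_fps_eqI[symmetric]) (auto simp: algebra_simps fps_eq_iff)

lemma binom_fps_power: "binom_fps x a ^ n = binom_fps x (of_nat n * a)"
  by (induction n) (simp_all add: binom_fps_add distrib_right)

lemma binom_fps_inverse: "binom_fps x a * binom_fps x (- a) = 1"
  by (simp flip: binom_fps_add)

lemma binom_fps_one_cancel: "(1 - fps_const x * fps_X) * binom_fps x 1 = 1"
  using binom_fps_inverse[of x "- 1"] by (simp add: binom_fps_minus_one)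

lemma fps_deriv_binom_fps:
  "fps_deriv (binom_fps x a) = fps_const (a * x) * binom_fps x 1 * binom_fps x a"
proof -
  have "fps_deriv (binom_fps x a) =
     ((1 - fps_const x * fps_X) * binom_fps x 1) * fps_deriv (binom_fps x a)"
    by (simp add: binom_fps_one_cancel)
  also have "\<dots> = binom_fps x 1 * ((1 - fps_const x * fps_X) * fps_deriv (binom_fps x a))"
    by (simp only: mult_ac)
  also have "\<dots> = fps_const (a * x) * binom_fps x 1 * binom_fps x a"
    unfolding binom_fps_ode by (simp only: mult_ac)
  finally show ?thesis .
qed

lemma fps_deriv_exp_prod_binom:
  assumes "finite A"
  shows "fps_deriv (fps_exp y * (\<Prod>h\<in>A. binom_fps (x h) (a h))) =
     (fps_exp y * (\<Prod>h\<in>A. binom_fps (x h) (a h))) *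
     (fps_const y + (\<Sum>h\<in>A. fps_const (a h * x h) * binom_fps (x h) 1))"
  using assms
proof (induction A)
  case (insert b A)
  define P where "P = fps_exp y * (\<Prod>h\<in>A. binom_fps (x h) (a h))"
  have "fps_deriv (fps_exp y * (\<Prod>h\<in>insert b A. binom_fps (x h) (a h))) =
    fps_deriv (P * binom_fps (x b) (a b))"
    using insert by (simp add: P_def mult_ac)
  also have "\<dots> = P * binom_fps (x b) (a b) *
     (fps_const y + (\<Sum>h\<in>insert b A. fps_const (a h * x h) * binom_fps (x h) 1))"
    using insert by (simp add: P_def fps_deriv_binom_fps algebra_simps)
  finally show ?case using insert by (simp add: P_def mult_ac)
qed simp

text \<open>For a > -1 this is X^(-a-1) times the integral of t^a f(t) from 0 to X. It is given by
  its coefficients because the exponent a is real.\<close>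

definition weighted_int :: "real \<Rightarrow> real fps \<Rightarrow> real fps" where
  "weighted_int a f = Abs_fps (\<lambda>n. f $ n / (a + of_nat n + 1))"

lemma weighted_int_nth [simp]: "weighted_int a f $ n = f $ n / (a + of_nat n + 1)"
  by (simp add: weighted_int_def)

lemma weighted_int_ode:
  assumes "a > -1"
  shows "fps_X * fps_deriv (weighted_int a f) + fps_const (a + 1) * weighted_int a f = f"
proof (rule fps_ext)
  fix n
  have nz: "a + real n + 1 \<noteq> 0" using assms of_nat_0_le_iff[of n, where 'a=real] by linarith
  have "(fps_X * fps_deriv (weighted_int a f)) $ n = real n * (f $ n / (a + real n + 1))"
    by (cases n) simp_all
  then have "(fps_X * fps_deriv (weighted_int a f) + fps_const (a + 1) * weighted_int a f) $ n
    = (a + real n + 1) * (f $ n / (a + real n + 1))"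
    by (simp add: add_divide_distrib[symmetric] algebra_simps)
  with nz show "(fps_X * fps_deriv (weighted_int a f) + fps_const (a + 1) * weighted_int a f) $ n = f $ n"
    by simp
qed

text \<open>Multiplication by X shifts the denominators by one, which amounts to raising a by one.
  This is the origin of the pair of parameters \<open>d j - 1\<close> and \<open>d j\<close> in the
  diagonal part of the final formula.\<close>

lemma weighted_int_linear_factor:
  "weighted_int a (f * (1 - fps_const x * fps_X)) =
     weighted_int a f - fps_const x * fps_X * weighted_int (a + 1) f"
proof (rule fps_ext)
  fix n
  have *: "(f * (1 - fps_const x * fps_X)) $ n = f $ n - x * (if n = 0 then 0 else f $ (n - 1))"
    by (simp add: right_diff_distrib mult.left_commute[of f])
  show "weighted_int a (f * (1 - fps_const x * fps_X)) $ n =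
     (weighted_int a f - fps_const x * fps_X * weighted_int (a + 1) f) $ n"
  proof (cases n)
    case 0
    then show ?thesis unfolding weighted_int_nth * by (simp add: mult.assoc)
  next
    case (Suc k)
    have "a + 1 + real k + 1 = a + real n + 1" by (simp add: Suc)
    then show ?thesis
      unfolding weighted_int_nth * fps_sub_nth mult.assoc fps_mult_left_const_nth fps_X_mult_nth
      by (simp add: Suc diff_divide_distrib)
  qed
qed

text \<open>The homogeneous solution exp (y z) times the product of the (z + \<rho> h)^(- d h),
  freed of its singular factor (z + \<rho> J)^(- d J) and scaled to constant coefficient 1.\<close>

definition row_series :: "nat \<Rightarrow> (nat \<Rightarrow> real) \<Rightarrow> (nat \<Rightarrow> real) \<Rightarrow> real \<Rightarrow> nat \<Rightarrow> real fps" where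
  "row_series q d \<rho> y J = fps_exp y * (\<Prod>h\<in>{1..q} - {J}. binom_fps (xrow \<rho> J h) (d h))"

definition row_series_inv :: "nat \<Rightarrow> (nat \<Rightarrow> real) \<Rightarrow> (nat \<Rightarrow> real) \<Rightarrow> real \<Rightarrow> nat \<Rightarrow> real fps" where
  "row_series_inv q d \<rho> y J = fps_exp (- y) * (\<Prod>h\<in>{1..q} - {J}. binom_fps (xrow \<rho> J h) (- d h))"

lemma row_series_inverse: "row_series q d \<rho> y J * row_series_inv q d \<rho> y J = 1"
proof -
  have "fps_exp y * fps_exp (- y) = 1" by (simp flip: fps_exp_add_mult)
  moreover have "(\<Prod>h\<in>{1..q} - {J}. binom_fps (xrow \<rho> J h) (d h)) *
    (\<Prod>h\<in>{1..q} - {J}. binom_fps (xrow \<rho> J h) (- d h)) = 1"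
    unfolding prod.distrib[symmetric] binom_fps_inverse by simp
  ultimately show ?thesis
    unfolding row_series_def row_series_inv_def by (metis (no_types, lifting) mult.assoc mult.left_commute mult_1)
qed

lemma fps_nth_0_prod: "prod f A $ 0 = (\<Prod>a\<in>A. f a $ 0)" for f :: "'a \<Rightarrow> 'b :: comm_ring_1 fps"
  by (induction A rule: infinite_finite_induct) auto

lemma row_series_nth_0 [simp]: "row_series q d \<rho> y J $ 0 = 1"
  and row_series_inv_nth_0 [simp]: "row_series_inv q d \<rho> y J $ 0 = 1"
  by (simp_all add: row_series_def row_series_inv_def fps_nth_0_prod)

text \<open>The expansion at \<open>- \<rho> J\<close> of y minus the terms
  \<open>d h / (z + \<rho> h)\<close> with h different from J; the term for J itself is singular
  there and is kept apart.\<close>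

definition log_series :: "nat \<Rightarrow> (nat \<Rightarrow> real) \<Rightarrow> (nat \<Rightarrow> real) \<Rightarrow> real \<Rightarrow> nat \<Rightarrow> real fps" where
  "log_series q d \<rho> y J = fps_const y +
     (\<Sum>h\<in>{1..q} - {J}. fps_const (d h * xrow \<rho> J h) * binom_fps (xrow \<rho> J h) 1)"

lemma fps_deriv_row_series:
  "fps_deriv (row_series q d \<rho> y J) = row_series q d \<rho> y J * log_series q d \<rho> y J"
  unfolding row_series_def log_series_def by (rule fps_deriv_exp_prod_binom) simp

text \<open>The power series at \<open>- \<rho> J\<close> (in \<open>X = z + \<rho> J\<close>) of a solution of
  \<open>K' + (\<Sum>h. d h / (z + \<rho> h)) * K = y * K + d j / (z + \<rho> j)\<close>: for \<open>J \<noteq> j\<close> the one vanishing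
  there, for \<open>J = j\<close> the one with value \<open>1\<close>.\<close>

definition residue_kernel :: "nat \<Rightarrow> (nat \<Rightarrow> real) \<Rightarrow> (nat \<Rightarrow> real) \<Rightarrow> real \<Rightarrow> nat \<Rightarrow> nat \<Rightarrow> real fps" where
  "residue_kernel q d \<rho> y j J =
     (if J = j then fps_const (d j) * row_series q d \<rho> y j * weighted_int (d j - 1) (row_series_inv q d \<rho> y j)
      else fps_const (- d j * xrow \<rho> J j) * fps_X * row_series q d \<rho> y J *
        weighted_int (d J) (row_series_inv q d \<rho> y J * binom_fps (xrow \<rho> J j) 1))"

lemma residue_kernel_nth_0:
  assumes "d j > 0"
  shows "residue_kernel q d \<rho> y j J $ 0 = of_bool (J = j)"
  using assms by (simp add: residue_kernel_def mult.assoc)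

text \<open>Variation of constants, with the equation multiplied by X to stay among power series:
  \<open>row_series\<close> accounts for \<open>log_series\<close>, and the equation of
  \<open>weighted_int\<close> absorbs the singular term \<open>d J / X\<close>. For J different from
  j the leading factor X of the kernel turns \<open>d J\<close> into \<open>d J + 1\<close>, which
  is why the weight there is \<open>d J\<close> and on the diagonal \<open>d j - 1\<close>.\<close>

lemma residue_kernel_ode:
  assumes "d j > 0" "d J > 0"
  shows "fps_X * fps_deriv (residue_kernel q d \<rho> y j J) + fps_const (d J) * residue_kernel q d \<rho> y j J =
    fps_X * log_series q d \<rho> y J * residue_kernel q d \<rho> y j J +
    (if J = j then fps_const (d j) else - fps_const (d j * xrow \<rho> J j) * fps_X * binom_fps (xrow \<rho> J j) 1)"
proof (cases "J = j")
  case True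
  define Z where "Z = row_series q d \<rho> y j"
  define L where "L = log_series q d \<rho> y j"
  define W where "W = weighted_int (d j - 1) (row_series_inv q d \<rho> y j)"
  have W: "fps_X * fps_deriv W + fps_const (d j) * W = row_series_inv q d \<rho> y j"
    using weighted_int_ode[of "d j - 1" "row_series_inv q d \<rho> y j"] assms by (simp add: W_def)
  have Z: "Z * row_series_inv q d \<rho> y j = 1" unfolding Z_def by (rule row_series_inverse)
  have "fps_deriv Z = Z * L" unfolding Z_def L_def by (rule fps_deriv_row_series)
  then have "fps_X * fps_deriv (fps_const (d j) * Z * W) + fps_const (d j) * (fps_const (d j) * Z * W)
    = fps_X * L * (fps_const (d j) * Z * W)
      + fps_const (d j) * (Z * (fps_X * fps_deriv W + fps_const (d j) * W))"
    by (simp add: algebra_simps)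
  then have "fps_X * fps_deriv (fps_const (d j) * Z * W) + fps_const (d j) * (fps_const (d j) * Z * W)
    = fps_X * L * (fps_const (d j) * Z * W) + fps_const (d j)"
    by (simp only: W Z mult_1_right)
  moreover have "residue_kernel q d \<rho> y j j = fps_const (d j) * Z * W"
    by (simp add: residue_kernel_def Z_def W_def)
  ultimately show ?thesis using True by (simp only: L_def if_True refl)
next
  case False
  define Z where "Z = row_series q d \<rho> y J"
  define L where "L = log_series q d \<rho> y J"
  define b where "b = binom_fps (xrow \<rho> J j) 1"
  define c where "c = fps_const (- d j * xrow \<rho> J j)"
  define W where "W = weighted_int (d J) (row_series_inv q d \<rho> y J * b)"
  have c': "fps_deriv c = 0" by (simp add: c_def)
  have W: "fps_X * fps_deriv W + fps_const (d J + 1) * W = row_series_inv q d \<rho> y J * b"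
    unfolding W_def using assms by (intro weighted_int_ode) simp
  have Z: "Z * (row_series_inv q d \<rho> y J * b) = b"
    unfolding Z_def mult.assoc[symmetric] by (simp add: row_series_inverse)
  define D where "D = fps_const (d J)"
  have dc: "fps_const (d J + 1) = D + 1"
    unfolding D_def by (simp flip: fps_const_1_eq_1)
  have "fps_deriv Z = Z * L" unfolding Z_def L_def by (rule fps_deriv_row_series)
  then have "fps_X * fps_deriv (c * fps_X * Z * W) + D * (c * fps_X * Z * W)
    = fps_X * L * (c * fps_X * Z * W)
      + c * fps_X * (Z * (fps_X * fps_deriv W + fps_const (d J + 1) * W))"
    unfolding dc by (simp add: c' algebra_simps)
  then have "fps_X * fps_deriv (c * fps_X * Z * W) + fps_const (d J) * (c * fps_X * Z * W)
    = fps_X * L * (c * fps_X * Z * W) + c * fps_X * b"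
    by (simp only: W Z D_def)
  moreover have "residue_kernel q d \<rho> y j J = c * fps_X * Z * W"
    using False by (simp add: residue_kernel_def Z_def W_def c_def b_def)
  moreover have "c = - fps_const (d j * xrow \<rho> J j)" by (simp add: c_def)
  ultimately show ?thesis using False by (simp only: L_def b_def if_False)
qed

text \<open>The coefficient of X^(k+1) in the kernel equation, arranged in the geometric sums that
  partial fractions of \<open>log_deriv\<close> times a pole produce.\<close>

lemma residue_kernel_recurrence:
  assumes "d j > 0" "d J > 0"
  shows "(real (Suc k) + d J) * residue_kernel q d \<rho> y j J $ Suc k =
    y * residue_kernel q d \<rho> y j J $ k +
    (\<Sum>h\<in>{1..q} - {J}. d h * xrow \<rho> J h * (\<Sum>l\<le>k. xrow \<rho> J h ^ l * residue_kernel q d \<rho> y j J $ (k - l)))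
    - (if J = j then 0 else d j * xrow \<rho> J j * xrow \<rho> J j ^ k)"
proof -
  define K where "K = residue_kernel q d \<rho> y j J"
  have b: "binom_fps x 1 $ l = x ^ l" for x l
    by (simp add: pochhammer_fact[symmetric])
  have L: "(fps_X * fps_deriv K + fps_const (d J) * K) $ Suc k = (real (Suc k) + d J) * K $ Suc k"
    by (simp add: distrib_right)
  have B: "(binom_fps x 1 * K) $ k = (\<Sum>l\<le>k. x ^ l * K $ (k - l))" for x
    unfolding fps_mult_nth b by (simp add: atMost_atLeast0)
  have "(fps_X * log_series q d \<rho> y J * K) $ Suc k = (log_series q d \<rho> y J * K) $ k"
    by (simp only: mult.assoc fps_X_mult_nth nat.distinct if_False diff_Suc_1)
  also have "log_series q d \<rho> y J * K = fps_const y * K +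
     (\<Sum>h\<in>{1..q} - {J}. fps_const (d h * xrow \<rho> J h) * (binom_fps (xrow \<rho> J h) 1 * K))"
    by (simp only: log_series_def distrib_right sum_distrib_right mult.assoc)
  also have "\<dots> $ k = y * K $ k +
      (\<Sum>h\<in>{1..q} - {J}. d h * xrow \<rho> J h * (\<Sum>l\<le>k. xrow \<rho> J h ^ l * K $ (k - l)))"
    by (simp only: fps_add_nth fps_sum_nth fps_mult_left_const_nth B)
  finally have M: "(fps_X * log_series q d \<rho> y J * K) $ Suc k = \<dots>" .
  define g where "g = (if J = j then fps_const (d j)
    else - fps_const (d j * xrow \<rho> J j) * fps_X * binom_fps (xrow \<rho> J j) 1)"
  have G: "g $ Suc k = - (if J = j then 0 else d j * xrow \<rho> J j * xrow \<rho> J j ^ k)"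
    by (simp add: g_def mult.assoc b del: binom_fps_nth)
  have "(fps_X * fps_deriv K + fps_const (d J) * K) $ Suc k =
    (fps_X * log_series q d \<rho> y J * K) $ Suc k + g $ Suc k"
    unfolding K_def residue_kernel_ode[OF assms, of q \<rho> y] g_def by (simp only: fps_add_nth)
  then show ?thesis
    unfolding L M G K_def[symmetric] by simp
qed

text \<open>The right-hand side of the normalization divided by \<open>gamma_product\<close>,
  expanded at \<open>- \<rho> J\<close> after removal of the pole (z + \<rho> J)^(- m J) and of the
  leading coefficient \<open>kappa\<close>.\<close>

definition factor_series :: "nat \<Rightarrow> nat \<Rightarrow> (nat \<Rightarrow> real) \<Rightarrow> (nat \<Rightarrow> real) \<Rightarrow> (nat \<Rightarrow> nat) \<Rightarrow> (nat \<Rightarrow> nat) \<Rightarrow> nat \<Rightarrow> real fps" where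
  "factor_series p q \<rho> \<xi> m n J =
     (\<Prod>i=1..p. binom_fps (1 / ccol \<rho> \<xi> i J) (- real (n i))) *
     (\<Prod>h\<in>{1..q} - {J}. binom_fps (xrow \<rho> J h) (real (m h)))"

section \<open>The residue functional\<close>

text \<open>Iteration of 1 / (b a) = x / b - x / a. With a = z + \<rho> I, b = z + \<rho> h and x
  the corresponding \<open>xrow\<close>, it reduces mixed quotients to pure poles.\<close>

lemma partial_fraction_step:
  fixes a b x :: real
  assumes "a \<noteq> 0" "b \<noteq> 0" "x * (b - a) = - 1"
  shows "1 / (b * a ^ Suc k) = x ^ Suc k / b - (\<Sum>l\<le>k. x ^ Suc l / a ^ Suc (k - l))"
proof (induction k)
  case 0
  show ?case using assms by (simp add: field_simps)
next
  case (Suc k)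
  have ab: "1 / (b * a) = x / b - x / a" using assms by (simp add: field_simps)
  have "1 / (b * a ^ Suc (Suc k)) = 1 / a * (1 / (b * a ^ Suc k))" by (simp add: field_simps)
  also have "\<dots> = x ^ Suc k * (1 / (b * a)) - (\<Sum>l\<le>k. x ^ Suc l / a ^ Suc (Suc k - l))"
    unfolding Suc right_diff_distrib sum_distrib_left
    by (simp add: Suc_diff_le mult.commute)
  also have "\<dots> = x ^ Suc (Suc k) / b - (\<Sum>l\<le>Suc k. x ^ Suc l / a ^ Suc (Suc k - l))"
    unfolding ab by (simp add: algebra_simps)
  finally show ?case .
qed

locale row_data =
  fixes q :: nat and d \<rho> :: "nat \<Rightarrow> real" and z0 y :: real and j :: nat
  assumes d_pos: "h \<in> {1..q} \<Longrightarrow> d h > 0"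
    and rho_inj: "inj_on \<rho> {1..q}"
    and z0_ge: "h \<in> {1..q} \<Longrightarrow> - \<rho> h \<le> z0"
    and j_in: "j \<in> {1..q}"
begin

abbreviation K :: "nat \<Rightarrow> real fps" where "K \<equiv> residue_kernel q d \<rho> y j"

text \<open>The linear functional on rational functions with poles in the points \<open>- \<rho> h\<close> that sums the
  residues against the kernels \<open>K h\<close>, given as a relation by its values on partial fractions.\<close>

inductive pf_value :: "(real \<Rightarrow> real) \<Rightarrow> real \<Rightarrow> bool" where
  base: "I \<in> {1..q} \<Longrightarrow> pf_value (\<lambda>z. 1 / (z + \<rho> I) ^ Suc k) (K I $ k)"
| zero: "pf_value (\<lambda>z. 0) 0"
| add: "pf_value f v \<Longrightarrow> pf_value g w \<Longrightarrow> pf_value (\<lambda>z. f z + g z) (v + w)"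
| scale: "pf_value f v \<Longrightarrow> pf_value (\<lambda>z. c * f z) (c * v)"
| agree: "pf_value f v \<Longrightarrow> (\<And>z. z > z0 \<Longrightarrow> g z = f z) \<Longrightarrow> pf_value g v"

lemma pf_value_sum:
  assumes "\<And>a. a \<in> A \<Longrightarrow> pf_value (f a) (v a)"
  shows "pf_value (\<lambda>z. \<Sum>a\<in>A. f a z) (\<Sum>a\<in>A. v a)"
  using assms by (induction A rule: infinite_finite_induct) (auto intro: pf_value.zero pf_value.add)

lemma pos: "z > z0 \<Longrightarrow> h \<in> {1..q} \<Longrightarrow> z + \<rho> h > 0"
  using z0_ge[of h] by linarith

lemma K_nth_0: "K h $ 0 = of_bool (h = j)"
  by (rule residue_kernel_nth_0) (rule d_pos[OF j_in])

definition log_deriv :: "real \<Rightarrow> real" where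
  "log_deriv z = (\<Sum>h=1..q. d h / (z + \<rho> h))"

text \<open>The adjointness of the kernels, tested on one pole. The function on the left is minus
  the derivative of 1 / (z + \<rho> I)^(k+1) plus \<open>log_deriv\<close> times it; its partial
  fractions have poles at \<open>- \<rho> I\<close> and simple poles at the other points.\<close>

lemma pf_value_log_deriv_base:
  assumes I: "I \<in> {1..q}"
  shows "pf_value (\<lambda>z. real (Suc k) * (1 / (z + \<rho> I) ^ Suc (Suc k)) + log_deriv z * (1 / (z + \<rho> I) ^ Suc k))
    (y * K I $ k)"
proof -
  define x where "x h = xrow \<rho> I h" for h
  define A where "A = {1..q} - {I}"
  have part: "pf_value (\<lambda>z. 1 / ((z + \<rho> h) * (z + \<rho> I) ^ Suc k))
      (x h ^ Suc k * K h $ 0 + (\<Sum>l\<le>k. - (x h ^ Suc l) * K I $ (k - l)))" if h: "h \<in> A" for h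
  proof (rule pf_value.agree)
    show "pf_value (\<lambda>z. x h ^ Suc k * (1 / (z + \<rho> h) ^ Suc 0) +
        (\<Sum>l\<le>k. - (x h ^ Suc l) * (1 / (z + \<rho> I) ^ Suc (k - l))))
      (x h ^ Suc k * K h $ 0 + (\<Sum>l\<le>k. - (x h ^ Suc l) * K I $ (k - l)))"
      using h I by (intro pf_value.add pf_value.scale pf_value_sum pf_value.base) (auto simp: A_def)
    fix z assume z: "z > z0"
    have hq: "h \<in> {1..q}" "h \<noteq> I" using h by (auto simp: A_def)
    have "\<rho> h \<noteq> \<rho> I" using inj_on_eq_iff[OF rho_inj hq(1) I] hq(2) by simp
    then have "x h * ((z + \<rho> h) - (z + \<rho> I)) = - 1" by (simp add: x_def xrow_def)
    then show "1 / ((z + \<rho> h) * (z + \<rho> I) ^ Suc k) = x h ^ Suc k * (1 / (z + \<rho> h) ^ Suc 0) +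
        (\<Sum>l\<le>k. - (x h ^ Suc l) * (1 / (z + \<rho> I) ^ Suc (k - l)))"
      using partial_fraction_step[of "z + \<rho> I" "z + \<rho> h" "x h" k] pos[OF z hq(1)] pos[OF z I]
      by (simp add: sum_negf)
  qed
  have "pf_value (\<lambda>z. (real (Suc k) + d I) * (1 / (z + \<rho> I) ^ Suc (Suc k)) +
      (\<Sum>h\<in>A. d h * (1 / ((z + \<rho> h) * (z + \<rho> I) ^ Suc k))))
    ((real (Suc k) + d I) * K I $ Suc k +
      (\<Sum>h\<in>A. d h * (x h ^ Suc k * K h $ 0 + (\<Sum>l\<le>k. - (x h ^ Suc l) * K I $ (k - l)))))"
    using I by (intro pf_value.add pf_value.scale pf_value_sum pf_value.base part)
  moreover have "(real (Suc k) + d I) * K I $ Suc k +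
      (\<Sum>h\<in>A. d h * (x h ^ Suc k * K h $ 0 + (\<Sum>l\<le>k. - (x h ^ Suc l) * K I $ (k - l)))) = y * K I $ k"
  proof -
    \<comment> \<open>A simple pole at \<open>- \<rho> h\<close> sees only \<open>K h $ 0\<close>,
      which is nonzero for h = j alone. What remains is exactly the inhomogeneous term of the
      recurrence, so the two cancel.\<close>
    have "(\<Sum>h\<in>A. d h * (x h ^ Suc k * K h $ 0)) = (\<Sum>h\<in>A. if h = j then d h * x h * x h ^ k else 0)"
      by (intro sum.cong) (auto simp: K_nth_0)
    also have "\<dots> = (if I = j then 0 else d j * x j * x j ^ k)"
      using j_in by (subst sum.delta) (auto simp: A_def)
    finally have 1: "(\<Sum>h\<in>A. d h * (x h ^ Suc k * K h $ 0)) = (if I = j then 0 else d j * x j * x j ^ k)" .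
    have 2: "(\<Sum>h\<in>A. d h * (\<Sum>l\<le>k. - (x h ^ Suc l) * K I $ (k - l))) =
      - (\<Sum>h\<in>A. d h * x h * (\<Sum>l\<le>k. x h ^ l * K I $ (k - l)))"
      by (simp add: sum_negf sum_distrib_left mult_ac)
    show ?thesis
      unfolding distrib_left sum.distrib 1 2
      unfolding distrib_left[symmetric]
      using residue_kernel_recurrence[OF d_pos[OF j_in] d_pos[OF I], where k = k and q = q and \<rho> = \<rho> and y = y]
      by (simp add: x_def A_def)
  qed
  ultimately have "pf_value (\<lambda>z. (real (Suc k) + d I) * (1 / (z + \<rho> I) ^ Suc (Suc k)) +
      (\<Sum>h\<in>A. d h * (1 / ((z + \<rho> h) * (z + \<rho> I) ^ Suc k)))) (y * K I $ k)" by simp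
  then show ?thesis
  proof (rule pf_value.agree)
    fix z assume z: "z > z0"
    have ld: "log_deriv z = d I / (z + \<rho> I) + (\<Sum>h\<in>A. d h / (z + \<rho> h))"
      unfolding log_deriv_def A_def using I by (subst sum.remove[of _ I]) auto
    have dI: "d I / (z + \<rho> I) * (1 / (z + \<rho> I) ^ Suc k) = d I * (1 / (z + \<rho> I) ^ Suc (Suc k))"
      by simp
    have dA: "(\<Sum>h\<in>A. d h / (z + \<rho> h)) * (1 / (z + \<rho> I) ^ Suc k) =
      (\<Sum>h\<in>A. d h * (1 / ((z + \<rho> h) * (z + \<rho> I) ^ Suc k)))"
      unfolding sum_distrib_right by (intro sum.cong refl) (simp only: times_divide_eq_right
        mult_1_right divide_divide_eq_left)
    show "real (Suc k) * (1 / (z + \<rho> I) ^ Suc (Suc k)) + log_deriv z * (1 / (z + \<rho> I) ^ Suc k) =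
      (real (Suc k) + d I) * (1 / (z + \<rho> I) ^ Suc (Suc k)) +
      (\<Sum>h\<in>A. d h * (1 / ((z + \<rho> h) * (z + \<rho> I) ^ Suc k)))"
      unfolding ld distrib_right dI dA by simp
  qed
qed

text \<open>Carries the operator that corresponds to multiplying a weight by its variable along a
  derivation of \<open>pf_value\<close>. Its image g is described through the derivative of f, the
  form in which it meets the differentiated Laplace integral.\<close>

lemma pf_value_deriv:
  assumes "pf_value f v"
  shows "\<exists>g. pf_value g (y * v) \<and>
    (\<forall>z>z0. (f has_field_derivative (log_deriv z * f z - g z)) (at z))"
  using assms
proof (induction rule: pf_value.induct)
  case (base I k)
  let ?g = "\<lambda>z. real (Suc k) * (1 / (z + \<rho> I) ^ Suc (Suc k)) + log_deriv z * (1 / (z + \<rho> I) ^ Suc k)"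
  have "((\<lambda>z. 1 / (z + \<rho> I) ^ Suc k) has_field_derivative
      (log_deriv z * (1 / (z + \<rho> I) ^ Suc k) - ?g z)) (at z)" if z: "z > z0" for z
  proof -
    have nz: "z + \<rho> I \<noteq> 0" using pos[OF z base] by simp
    have "((\<lambda>z. 1 / (z + \<rho> I) ^ Suc k) has_field_derivative
      - (real (Suc k) * (z + \<rho> I) ^ k / ((z + \<rho> I) ^ Suc k * (z + \<rho> I) ^ Suc k))) (at z)"
      using nz by (auto intro!: derivative_eq_intros simp del: power_Suc)
    moreover have "real (Suc k) * (z + \<rho> I) ^ k / ((z + \<rho> I) ^ Suc k * (z + \<rho> I) ^ Suc k)
      = real (Suc k) * (1 / (z + \<rho> I) ^ Suc (Suc k))"
      using nz by (simp del: of_nat_Suc)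
    ultimately show ?thesis by simp
  qed
  with pf_value_log_deriv_base[OF base] show ?case by blast
next
  case zero
  show ?case by (rule exI[of _ "\<lambda>z. 0"]) (auto intro: pf_value.zero)
next
  case (add f v g w)
  then obtain f' g' where "pf_value f' (y * v)" "pf_value g' (y * w)"
    and D: "\<forall>z>z0. (f has_field_derivative (log_deriv z * f z - f' z)) (at z)"
      "\<forall>z>z0. (g has_field_derivative (log_deriv z * g z - g' z)) (at z)" by blast
  then have "pf_value (\<lambda>z. f' z + g' z) (y * (v + w))"
    unfolding distrib_left by (intro pf_value.add)
  moreover have "((\<lambda>z. f z + g z) has_field_derivative (log_deriv z * (f z + g z) - (f' z + g' z))) (at z)"
    if "z > z0" for z
    using DERIV_add[OF D(1)[rule_format, OF that] D(2)[rule_format, OF that]] by (simp add: algebra_simps)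
  ultimately show ?case by (intro exI[of _ "\<lambda>z. f' z + g' z"]) blast
next
  case (scale f v c)
  then obtain f' where "pf_value f' (y * v)"
    and D: "\<forall>z>z0. (f has_field_derivative (log_deriv z * f z - f' z)) (at z)" by blast
  then have "pf_value (\<lambda>z. c * f' z) (y * (c * v))"
    unfolding mult.left_commute[of y] by (intro pf_value.scale)
  moreover have "((\<lambda>z. c * f z) has_field_derivative (log_deriv z * (c * f z) - c * f' z)) (at z)"
    if "z > z0" for z
    using DERIV_cmult[OF D[rule_format, OF that], of c] by (simp add: algebra_simps)
  ultimately show ?case by (intro exI[of _ "\<lambda>z. c * f' z"]) blast
next
  case (agree f v g)
  then obtain f' where f': "pf_value f' (y * v)"
    and D: "\<forall>z>z0. (f has_field_derivative (log_deriv z * f z - f' z)) (at z)" by blast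
  have "(g has_field_derivative (log_deriv z * g z - f' z)) (at z)" if z: "z > z0" for z
  proof (rule has_field_derivative_transform_within_open[of f _ _ "{z0<..}"])
    show "(f has_field_derivative (log_deriv z * g z - f' z)) (at z)"
      using D agree(2)[OF z] z by simp
  qed (use agree z in auto)
  with f' show ?case by blast
qed

definition gamma_product :: "real \<Rightarrow> real" where
  "gamma_product z = (\<Prod>h=1..q. (z + \<rho> h) powr (- d h))"

lemma gamma_product_pos: "z > z0 \<Longrightarrow> gamma_product z > 0"
  unfolding gamma_product_def using pos by (intro prod_pos) fastforce

lemma gamma_product_deriv:
  assumes z: "z > z0"
  shows "(gamma_product has_field_derivative - (log_deriv z * gamma_product z)) (at z)"
proof -
  have "((\<lambda>z. \<Prod>h=1..q. (z + \<rho> h) powr (- d h)) has_field_derivative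
     (\<Prod>h=1..q. (z + \<rho> h) powr (- d h)) *
     (\<Sum>h=1..q. (- d h * (z + \<rho> h) powr (- d h - 1)) / (z + \<rho> h) powr (- d h))) (at z)"
  proof (rule has_field_derivative_prod')
    fix h assume h: "h \<in> {1..q}"
    show "(z + \<rho> h) powr (- d h) \<noteq> 0" using pos[OF z h] by simp
    show "((\<lambda>z. (z + \<rho> h) powr (- d h)) has_field_derivative (- d h * (z + \<rho> h) powr (- d h - 1))) (at z)"
      using pos[OF z h] by (auto intro!: derivative_eq_intros)
  qed
  also have "(\<Sum>h=1..q. (- d h * (z + \<rho> h) powr (- d h - 1)) / (z + \<rho> h) powr (- d h)) = - log_deriv z"
    unfolding log_deriv_def sum_negf[symmetric]
  proof (rule sum.cong)
    fix h assume h: "h \<in> {1..q}"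
    have "(z + \<rho> h) powr (- d h - 1) / (z + \<rho> h) powr (- d h) = (z + \<rho> h) powr (-1)"
      by (simp flip: powr_diff)
    then show "- d h * (z + \<rho> h) powr (- d h - 1) / (z + \<rho> h) powr (- d h) = - (d h / (z + \<rho> h))"
      using pos[OF z h] unfolding times_divide_eq_right[symmetric] by (simp add: powr_minus_divide)
  qed simp
  finally show ?thesis unfolding gamma_product_def[abs_def] by (simp add: mult.commute)
qed

text \<open>Differentiating the Laplace integral brings down the factor -t. Comparison with the
  product rule for \<open>gamma_product z * g z\<close> identifies the next moment, and the
  functional gains a factor y.\<close>

lemma row_moment_pf_value:
  assumes i: "i \<in> {1..q}"
  shows "\<exists>g. pf_value g (y ^ k * of_bool (i = j)) \<and>
    (\<forall>z>z0. (\<integral>t. exp (- z * t) * (t ^ k * row_weight q d \<rho> i t) \<partial>lborel) = gamma_product z * g z)"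
proof (induction k)
  case 0
  have "pf_value (\<lambda>z. 1 / (z + \<rho> i) ^ Suc 0) (y ^ 0 * of_bool (i = j))"
    using pf_value.base[OF i, of 0] by (simp add: K_nth_0)
  moreover have "has_laplace z0 (row_weight q d \<rho> i) (\<lambda>z. gamma_product z / (z + \<rho> i))"
    unfolding gamma_product_def using i d_pos z0_ge by (intro has_laplace_row_weight) auto
  then have "(\<integral>t. exp (- z * t) * (t ^ 0 * row_weight q d \<rho> i t) \<partial>lborel)
      = gamma_product z * (1 / (z + \<rho> i) ^ Suc 0)" if "z > z0" for z
    using has_laplace_integrable(2)[OF _ that] by simp
  ultimately show ?case by blast
next
  case (Suc k)
  then obtain g where g: "pf_value g (y ^ k * of_bool (i = j))"
    and L: "\<And>z. z > z0 \<Longrightarrow>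
      (\<integral>t. exp (- z * t) * (t ^ k * row_weight q d \<rho> i t) \<partial>lborel) = gamma_product z * g z"
    by blast
  obtain g' where g': "pf_value g' (y * (y ^ k * of_bool (i = j)))"
    and D: "\<And>z. z > z0 \<Longrightarrow> (g has_field_derivative (log_deriv z * g z - g' z)) (at z)"
    using pf_value_deriv[OF g] by blast
  have "(\<integral>t. exp (- z * t) * (t ^ Suc k * row_weight q d \<rho> i t) \<partial>lborel) = gamma_product z * g' z"
    if z: "z > z0" for z
  proof -
    have "((\<lambda>z. gamma_product z * g z) has_field_derivative
        - (\<integral>t. exp (- z * t) * (t ^ Suc k * row_weight q d \<rho> i t) \<partial>lborel)) (at z)"
    proof (rule has_field_derivative_transform_within_open[of _ _ _ "{z0<..}"])
      show "((\<lambda>z. \<integral>t. exp (- z * t) * (t ^ k * row_weight q d \<rho> i t) \<partial>lborel) has_field_derivative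
          - (\<integral>t. exp (- z * t) * (t ^ Suc k * row_weight q d \<rho> i t) \<partial>lborel)) (at z)"
        using i d_pos z0_ge z by (intro row_weight_moment_deriv) auto
    qed (use L z in auto)
    moreover have "((\<lambda>z. gamma_product z * g z) has_field_derivative
        - (log_deriv z * gamma_product z) * g z + (log_deriv z * g z - g' z) * gamma_product z) (at z)"
      by (rule DERIV_mult[OF gamma_product_deriv[OF z] D[OF z]])
    ultimately have "- (\<integral>t. exp (- z * t) * (t ^ Suc k * row_weight q d \<rho> i t) \<partial>lborel) =
       - (log_deriv z * gamma_product z) * g z + (log_deriv z * g z - g' z) * gamma_product z"
      by (rule DERIV_unique)
    then show ?thesis by (simp add: algebra_simps)
  qed
  with g' show ?case by (auto simp: mult.assoc)
qed

text \<open>Expansion in monomials reduces this to moments of single rows. The rows other than j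
  have value 0, so only \<open>B j\<close> is left.\<close>

lemma linear_form_pf_value:
  "\<exists>g. pf_value g (poly (B j) y) \<and>
    (\<forall>z>z0. (LINT t:{0..}|lborel. exp (- z * t) * linear_form q d \<rho> B t) = gamma_product z * g z)"
proof -
  define g where "g i k = (SOME g. pf_value g (y ^ k * of_bool (i = j)) \<and> (\<forall>z>z0.
    (\<integral>t. exp (- z * t) * (t ^ k * row_weight q d \<rho> i t) \<partial>lborel) = gamma_product z * g z))" for i k
  have g: "pf_value (g i k) (y ^ k * of_bool (i = j))"
    and L: "z > z0 \<Longrightarrow>
      (\<integral>t. exp (- z * t) * (t ^ k * row_weight q d \<rho> i t) \<partial>lborel) = gamma_product z * g i k z"
    if "i \<in> {1..q}" for i k z
    using someI_ex[OF row_moment_pf_value[OF that, of k]] unfolding g_def by blast+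
  define G where "G z = (\<Sum>i=1..q. \<Sum>k\<le>degree (B i). coeff (B i) k * g i k z)" for z
  have "pf_value G (\<Sum>i=1..q. \<Sum>k\<le>degree (B i). coeff (B i) k * (y ^ k * of_bool (i = j)))"
    unfolding G_def[abs_def] by (intro pf_value_sum pf_value.scale g)
  also have "(\<Sum>i=1..q. \<Sum>k\<le>degree (B i). coeff (B i) k * (y ^ k * of_bool (i = j)))
    = (\<Sum>i=1..q. if i = j then poly (B i) y else 0)"
    by (intro sum.cong) (auto simp: poly_altdef)
  also have "\<dots> = poly (B j) y" using j_in by simp
  finally have "pf_value G (poly (B j) y)" .
  moreover have "(LINT t:{0..}|lborel. exp (- z * t) * linear_form q d \<rho> B t) = gamma_product z * G z"
    if z: "z > z0" for z
  proof -
    have int: "integrable lborel (\<lambda>t. exp (- z * t) * (t ^ k * row_weight q d \<rho> i t))"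
      if "i \<in> {1..q}" for i k
      using that d_pos z0_ge z by (intro row_weight_moment_deriv) auto
    have supp: "row_weight q d \<rho> i t = 0" if "i \<in> {1..q}" "t < 0" for i t
    proof -
      have "has_laplace z0 (row_weight q d \<rho> i) (\<lambda>z. (\<Prod>h=1..q. (z + \<rho> h) powr (- d h)) / (z + \<rho> i))"
        using that d_pos z0_ge by (intro has_laplace_row_weight) auto
      then show ?thesis using that by (simp add: has_laplace_def)
    qed
    have "(LINT t:{0..}|lborel. exp (- z * t) * linear_form q d \<rho> B t) =
      (\<integral>t. (\<Sum>i=1..q. \<Sum>k\<le>degree (B i).
        coeff (B i) k * (exp (- z * t) * (t ^ k * row_weight q d \<rho> i t))) \<partial>lborel)"
      unfolding set_lebesgue_integral_def
    proof (rule Bochner_Integration.integral_cong)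
      fix t :: real
      have "exp (- z * t) * linear_form q d \<rho> B t = (\<Sum>i=1..q. \<Sum>k\<le>degree (B i).
        coeff (B i) k * (exp (- z * t) * (t ^ k * row_weight q d \<rho> i t)))"
        unfolding linear_form_def poly_altdef sum_distrib_left sum_distrib_right
        by (intro sum.cong refl) (simp only: mult_ac)
      moreover have "linear_form q d \<rho> B t = 0" if "t < 0"
        unfolding linear_form_def using supp[OF _ that] by (intro sum.neutral) auto
      ultimately show "indicat_real {0..} t *\<^sub>R (exp (- z * t) * linear_form q d \<rho> B t) =
        (\<Sum>i=1..q. \<Sum>k\<le>degree (B i). coeff (B i) k * (exp (- z * t) * (t ^ k * row_weight q d \<rho> i t)))"
        by (cases "t < 0") (auto simp: indicator_def)
    qed simp
    also have "\<dots> = (\<Sum>i=1..q. \<Sum>k\<le>degree (B i).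
        coeff (B i) k * (\<integral>t. exp (- z * t) * (t ^ k * row_weight q d \<rho> i t) \<partial>lborel))"
      using int
      by (subst Bochner_Integration.integral_sum)
        (auto intro!: sum.cong Bochner_Integration.integrable_sum simp: Bochner_Integration.integral_sum)
    also have "\<dots> = gamma_product z * G z"
      unfolding G_def sum_distrib_left using L[OF _ z] by (intro sum.cong refl) (simp add: mult_ac)
    finally show ?thesis .
  qed
  ultimately show ?thesis by blast
qed
end

section \<open>Evaluation of the functional through polynomial numerators\<close>

lemma prod_fps_const: "(\<Prod>i\<in>A. fps_const (f i)) = fps_const (\<Prod>i\<in>A. f i)" for f :: "'a \<Rightarrow> real"
  by (induction A rule: infinite_finite_induct) (auto simp: fps_const_mult[symmetric] simp del: fps_const_mult)

context row_data
begin

text \<open>The Taylor expansion at \<open>- \<rho> J\<close>, in the variable X = z + \<rho>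
  J.\<close>

definition expansion :: "nat \<Rightarrow> real poly \<Rightarrow> real fps" where
  "expansion J P = fps_of_poly (pcompose P [:- \<rho> J, 1:])"

lemma expansion_mult: "expansion J (P * Q) = expansion J P * expansion J Q"
  by (simp add: expansion_def pcompose_mult fps_of_poly_mult)

lemma expansion_add: "expansion J (P + Q) = expansion J P + expansion J Q"
  by (simp add: expansion_def pcompose_add fps_of_poly_add)

lemma expansion_smult: "expansion J (smult c P) = fps_const c * expansion J P"
  by (simp add: expansion_def pcompose_smult fps_of_poly_smult)

lemma expansion_1 [simp]: "expansion J 1 = 1"
  by (simp add: expansion_def pcompose_1)

lemma expansion_0 [simp]: "expansion J 0 = 0"
  by (simp add: expansion_def)

lemma expansion_power: "expansion J (P ^ k) = expansion J P ^ k"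
  by (induction k) (simp_all add: expansion_mult)

lemma expansion_prod: "expansion J (\<Prod>i\<in>A. f i) = (\<Prod>i\<in>A. expansion J (f i))"
  by (induction A rule: infinite_finite_induct) (simp_all add: expansion_mult)

lemma expansion_linear: "expansion J [:a, 1:] = fps_const (a - \<rho> J) + fps_X"
  by (simp add: expansion_def pcompose_pCons fps_of_poly_linear add.commute)

text \<open>The expansion of 1 / (z + \<rho> h) at \<open>- \<rho> J\<close>, which is -x / (1 - x
  X) with x = \<open>xrow \<rho> J h\<close>.\<close>

definition inv_factor :: "nat \<Rightarrow> nat \<Rightarrow> real fps" where
  "inv_factor J h = fps_const (- xrow \<rho> J h) * binom_fps (xrow \<rho> J h) 1"

lemma expansion_inv_factor:
  assumes "h \<in> {1..q}" "J \<in> {1..q}" "h \<noteq> J"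
  shows "expansion J [:\<rho> h, 1:] * inv_factor J h = 1"
proof -
  define x where "x = xrow \<rho> J h"
  have ne: "\<rho> h - \<rho> J \<noteq> 0" using inj_on_eq_iff[OF rho_inj assms(1,2)] assms(3) by simp
  have "(\<rho> h - \<rho> J) * - x = 1" using ne by (simp add: x_def xrow_def)
  then have "fps_const (\<rho> h - \<rho> J) * fps_const (- x) = 1"
    unfolding fps_const_mult by simp
  then have "(fps_const (\<rho> h - \<rho> J) + fps_X) * fps_const (- x) = 1 + fps_X * fps_const (- x)"
    by (simp only: distrib_right)
  also have "\<dots> = 1 - fps_const x * fps_X" by (simp add: fps_const_neg[symmetric] del: fps_const_neg)
  finally have *: "(fps_const (\<rho> h - \<rho> J) + fps_X) * fps_const (- x) = 1 - fps_const x * fps_X" .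
  show ?thesis
    unfolding expansion_linear inv_factor_def x_def[symmetric] mult.assoc[symmetric] *
    by (rule binom_fps_one_cancel)
qed

definition outer_inv :: "nat \<Rightarrow> real fps" where
  "outer_inv J = (\<Prod>h\<in>{1..q} - {J}. inv_factor J h)"

text \<open>The value of the functional on \<open>P / (\<Prod>h. (z + \<rho> h) ^ M)\<close>.\<close>

definition residue_value :: "nat \<Rightarrow> real poly \<Rightarrow> real" where
  "residue_value M P = (\<Sum>J=1..q. (expansion J P * outer_inv J ^ M * K J) $ (M - 1))"

definition row_poly :: "(nat \<Rightarrow> nat) \<Rightarrow> real poly" where
  "row_poly e = (\<Prod>h=1..q. [:\<rho> h, 1:] ^ e h)"

lemma poly_row_poly: "poly (row_poly e) z = (\<Prod>h=1..q. (z + \<rho> h) ^ e h)"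
  by (simp add: row_poly_def poly_prod add.commute)

lemma expansion_row_poly:
  assumes J: "J \<in> {1..q}" and e: "\<And>h. h \<in> {1..q} \<Longrightarrow> e h \<le> M"
  shows "expansion J (row_poly e) * outer_inv J ^ M =
    fps_X ^ e J * (\<Prod>h\<in>{1..q} - {J}. inv_factor J h ^ (M - e h))"
proof -
  have "expansion J (row_poly e) = fps_X ^ e J * (\<Prod>h\<in>{1..q} - {J}. expansion J [:\<rho> h, 1:] ^ e h)"
    unfolding row_poly_def expansion_prod expansion_power
    using J by (subst prod.remove[of _ J]) (simp_all add: expansion_linear)
  moreover have "(\<Prod>h\<in>{1..q} - {J}. expansion J [:\<rho> h, 1:] ^ e h) * outer_inv J ^ M =
    (\<Prod>h\<in>{1..q} - {J}. inv_factor J h ^ (M - e h))"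
    unfolding outer_inv_def prod_power_distrib prod.distrib[symmetric]
  proof (rule prod.cong)
    fix h assume h: "h \<in> {1..q} - {J}"
    have "inv_factor J h ^ M = inv_factor J h ^ e h * inv_factor J h ^ (M - e h)"
      using e[of h] h by (simp flip: power_add)
    then have "expansion J [:\<rho> h, 1:] ^ e h * inv_factor J h ^ M =
      (expansion J [:\<rho> h, 1:] * inv_factor J h) ^ e h * inv_factor J h ^ (M - e h)"
      by (simp only: power_mult_distrib mult.assoc)
    then show "expansion J [:\<rho> h, 1:] ^ e h * inv_factor J h ^ M = inv_factor J h ^ (M - e h)"
      using expansion_inv_factor[of h J] h J by simp
  qed simp
  ultimately show ?thesis by (simp only: mult.assoc)
qed

text \<open>Cancelling the common factors lowers the order of the pole at \<open>- \<rho> J\<close>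
  from M to \<open>M - e J\<close>; for \<open>e J = M\<close> no pole is left and the point
  contributes nothing.\<close>

lemma residue_value_row_poly:
  assumes e: "\<And>h. h \<in> {1..q} \<Longrightarrow> e h \<le> M" and M: "M \<ge> 1"
  shows "residue_value M (P * row_poly e) =
    (\<Sum>J=1..q. if e J < M then
      (expansion J P * (\<Prod>h\<in>{1..q} - {J}. inv_factor J h ^ (M - e h)) * K J) $ (M - 1 - e J) else 0)"
  unfolding residue_value_def
proof (rule sum.cong)
  fix J assume J: "J \<in> {1..q}"
  define R where "R = (\<Prod>h\<in>{1..q} - {J}. inv_factor J h ^ (M - e h))"
  have X: "expansion J (row_poly e) * outer_inv J ^ M = fps_X ^ e J * R"
    unfolding R_def by (rule expansion_row_poly[of J e M]) (use J e in auto)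
  have "expansion J (P * row_poly e) * outer_inv J ^ M * K J =
     expansion J P * (expansion J (row_poly e) * outer_inv J ^ M) * K J"
    by (simp only: expansion_mult mult.assoc)
  also have "\<dots> = fps_X ^ e J * (expansion J P * R * K J)"
    unfolding X by (simp only: mult_ac)
  finally have "(expansion J (P * row_poly e) * outer_inv J ^ M * K J) $ (M - 1) =
    (if M - 1 < e J then 0 else (expansion J P * R * K J) $ (M - 1 - e J))"
    by (simp only: fps_X_power_mult_nth)
  moreover have "M - 1 < e J \<longleftrightarrow> \<not> e J < M" using M by auto
  ultimately show "(expansion J (P * row_poly e) * outer_inv J ^ M * K J) $ (M - 1) =
    (if e J < M then (expansion J P * (\<Prod>h\<in>{1..q} - {J}. inv_factor J h ^ (M - e h)) * K J) $ (M - 1 - e J) else 0)"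
    by (simp only: R_def if_not_P if_P split: if_split) blast
qed simp

text \<open>A function may have several derivations in \<open>pf_value\<close>, so it is not evident
  that its value is unique. The numerator over a common denominator depends on the function alone.
  The claim is made for all large M so that two summands can be brought to the same M.\<close>

lemma pf_value_numerator:
  assumes "pf_value f v"
  shows "\<exists>M0. \<forall>M\<ge>M0. \<exists>P. (\<forall>z>z0. f z * (\<Prod>h=1..q. (z + \<rho> h) ^ M) = poly P z) \<and> residue_value M P = v"
  using assms
proof (induction rule: pf_value.induct)
  case (base I k)
  have "\<exists>P. (\<forall>z>z0. 1 / (z + \<rho> I) ^ Suc k * (\<Prod>h=1..q. (z + \<rho> h) ^ M) = poly P z) \<and>
      residue_value M P = K I $ k" if M: "M \<ge> Suc k" for M
  proof (intro exI conjI allI impI)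
    \<comment> \<open>The numerator of the pole over the common denominator is
      \<open>row_poly e\<close>. Its exponent is M at every point other than
      \<open>- \<rho> I\<close>, so only the residue at that point survives.\<close>
    define e where "e h = (if h = I then M - Suc k else M)" for h
    have lt: "e J < M \<longleftrightarrow> J = I" for J using M by (auto simp: e_def)
    have "residue_value M (1 * row_poly e) = (\<Sum>J=1..q. if J = I then K I $ k else 0)"
    proof (subst residue_value_row_poly)
      have *: "(\<Prod>h\<in>{1..q} - {I}. inv_factor I h ^ (M - e h)) = 1"
        by (intro prod.neutral) (simp add: e_def)
      have "M - 1 - e I = k" using M by (simp add: e_def)
      then show "(\<Sum>J=1..q. if e J < M then
        (expansion J 1 * (\<Prod>h\<in>{1..q} - {J}. inv_factor J h ^ (M - e h)) * K J) $ (M - 1 - e J) else 0) =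
        (\<Sum>J=1..q. if J = I then K I $ k else 0)"
        unfolding lt using * by (intro sum.cong refl) (simp del: One_nat_def)
    qed (use M in \<open>auto simp: e_def\<close>)
    then show "residue_value M (row_poly e) = K I $ k" using base by simp
    fix z assume z: "z > z0"
    have nz: "z + \<rho> I \<noteq> 0" using pos[OF z base] by simp
    have "(z + \<rho> I) ^ M = (z + \<rho> I) ^ Suc k * (z + \<rho> I) ^ e I"
      unfolding power_add[symmetric] using M by (simp add: e_def)
    moreover have "(\<Prod>h\<in>{1..q} - {I}. (z + \<rho> h) ^ M) = (\<Prod>h\<in>{1..q} - {I}. (z + \<rho> h) ^ e h)"
      by (intro prod.cong) (auto simp: e_def)
    ultimately have "(\<Prod>h=1..q. (z + \<rho> h) ^ M) = (z + \<rho> I) ^ Suc k * (\<Prod>h=1..q. (z + \<rho> h) ^ e h)"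
      using base by (subst (1 2) prod.remove[of _ I]) (simp_all only: finite_atLeastAtMost mult.assoc)
    then show "1 / (z + \<rho> I) ^ Suc k * (\<Prod>h=1..q. (z + \<rho> h) ^ M) = poly (row_poly e) z"
      using nz by (simp add: poly_row_poly del: power_Suc)
  qed
  then show ?case by blast
next
  case zero
  have "residue_value M 0 = 0" for M by (simp add: residue_value_def)
  then have "\<exists>P. (\<forall>z>z0. 0 * (\<Prod>h=1..q. (z + \<rho> h) ^ M) = poly P z) \<and> residue_value M P = 0" for M
    by (intro exI[of _ "0 :: real poly"]) simp
  then show ?case by blast
next
  case (add f v g w)
  then obtain M1 M2 where
    1: "\<And>M. M \<ge> M1 \<Longrightarrow> \<exists>P. (\<forall>z>z0. f z * (\<Prod>h=1..q. (z + \<rho> h) ^ M) = poly P z) \<and> residue_value M P = v" and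
    2: "\<And>M. M \<ge> M2 \<Longrightarrow> \<exists>P. (\<forall>z>z0. g z * (\<Prod>h=1..q. (z + \<rho> h) ^ M) = poly P z) \<and> residue_value M P = w"
    by blast
  show ?case
  proof (intro exI[of _ "max M1 M2"] allI impI)
    fix M assume "M \<ge> max M1 M2"
    then obtain P1 P2 where
      "\<forall>z>z0. f z * (\<Prod>h=1..q. (z + \<rho> h) ^ M) = poly P1 z" "residue_value M P1 = v"
      "\<forall>z>z0. g z * (\<Prod>h=1..q. (z + \<rho> h) ^ M) = poly P2 z" "residue_value M P2 = w"
      using 1[of M] 2[of M] by auto
    then show "\<exists>P. (\<forall>z>z0. (f z + g z) * (\<Prod>h=1..q. (z + \<rho> h) ^ M) = poly P z) \<and> residue_value M P = v + w"
      by (intro exI[of _ "P1 + P2"])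
        (simp add: distrib_right residue_value_def expansion_add sum.distrib)
  qed
next
  case (scale f v c)
  then obtain M0 where
    1: "\<And>M. M \<ge> M0 \<Longrightarrow> \<exists>P. (\<forall>z>z0. f z * (\<Prod>h=1..q. (z + \<rho> h) ^ M) = poly P z) \<and> residue_value M P = v"
    by blast
  show ?case
  proof (intro exI[of _ M0] allI impI)
    fix M assume "M \<ge> M0"
    then obtain P where "\<forall>z>z0. f z * (\<Prod>h=1..q. (z + \<rho> h) ^ M) = poly P z" "residue_value M P = v"
      using 1 by blast
    moreover have "residue_value M (smult c P) = c * residue_value M P"
      by (simp add: residue_value_def expansion_smult mult.assoc sum_distrib_left)
    ultimately show "\<exists>P. (\<forall>z>z0. c * f z * (\<Prod>h=1..q. (z + \<rho> h) ^ M) = poly P z) \<and> residue_value M P = c * v"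
      by (intro exI[of _ "smult c P"]) (simp add: mult.assoc)
  qed
next
  case (agree f v g)
  then show ?case by simp
qed

text \<open>Two numerators of g, one over the exponents \<open>m h\<close> and one over a large
  common exponent, agree on a half-line up to the factor \<open>row_poly e\<close>, hence as
  polynomials; \<open>residue_value_row_poly\<close> then cancels that factor.\<close>

lemma pf_value_rational:
  assumes g: "pf_value g v" and m: "\<And>h. h \<in> {1..q} \<Longrightarrow> m h \<ge> 1"
    and P: "\<And>z. z > z0 \<Longrightarrow> g z * (\<Prod>h=1..q. (z + \<rho> h) ^ m h) = poly P z"
  shows "v = (\<Sum>J=1..q. (expansion J P * (\<Prod>h\<in>{1..q} - {J}. inv_factor J h ^ m h) * K J) $ (m J - 1))"
proof -
  obtain M0 where M0: "\<And>M. M \<ge> M0 \<Longrightarrow>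
      \<exists>P. (\<forall>z>z0. g z * (\<Prod>h=1..q. (z + \<rho> h) ^ M) = poly P z) \<and> residue_value M P = v"
    using pf_value_numerator[OF g] by blast
  \<comment> \<open>Large enough for \<open>M0\<close>, positive, and above every
    \<open>m h\<close>, so that \<open>M - m h\<close> is not truncated.\<close>
  define M where "M = max (Suc M0) (\<Sum>h=1..q. m h)"
  have mM: "m h \<le> M" if "h \<in> {1..q}" for h
    using member_le_sum[of h "{1..q}" m] that by (auto simp: M_def)
  have "M \<ge> M0" by (simp add: M_def)
  from M0[OF this] obtain P' where P': "\<And>z. z > z0 \<Longrightarrow> g z * (\<Prod>h=1..q. (z + \<rho> h) ^ M) = poly P' z"
    and v: "residue_value M P' = v" by blast
  define e where "e h = M - m h" for h
  have "P' = P * row_poly e"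
  proof (rule ccontr)
    assume "P' \<noteq> P * row_poly e"
    then have "finite {z. poly (P' - P * row_poly e) z = 0}" by (intro poly_roots_finite) simp
    moreover have "{z0<..} \<subseteq> {z. poly (P' - P * row_poly e) z = 0}"
    proof (rule subsetI)
      fix z assume z: "z \<in> {z0<..}"
      have "(\<Prod>h=1..q. (z + \<rho> h) ^ M) = (\<Prod>h=1..q. (z + \<rho> h) ^ m h) * (\<Prod>h=1..q. (z + \<rho> h) ^ e h)"
        unfolding prod.distrib[symmetric] power_add[symmetric]
        using mM by (intro prod.cong) (auto simp: e_def)
      then show "z \<in> {z. poly (P' - P * row_poly e) z = 0}"
        using P'[of z] P[of z] z by (simp add: poly_row_poly mult.assoc[symmetric])
    qed
    ultimately show False using infinite_Ioi finite_subset by blast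
  qed
  then have "v = residue_value M (P * row_poly e)" using v by simp
  also have "\<dots> = (\<Sum>J=1..q. if e J < M then
      (expansion J P * (\<Prod>h\<in>{1..q} - {J}. inv_factor J h ^ (M - e h)) * K J) $ (M - 1 - e J) else 0)"
    by (rule residue_value_row_poly) (auto simp: e_def M_def)
  also have "\<dots> = (\<Sum>J=1..q. (expansion J P * (\<Prod>h\<in>{1..q} - {J}. inv_factor J h ^ m h) * K J) $ (m J - 1))"
  proof (rule sum.cong)
    fix J assume J: "J \<in> {1..q}"
    have "e J < M" "M - 1 - e J = m J - 1" using m[OF J] mM[OF J] by (auto simp: e_def)
    moreover have "(\<Prod>h\<in>{1..q} - {J}. inv_factor J h ^ (M - e h)) = (\<Prod>h\<in>{1..q} - {J}. inv_factor J h ^ m h)"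
      using mM by (intro prod.cong) (auto simp: e_def)
    ultimately show "(if e J < M then
      (expansion J P * (\<Prod>h\<in>{1..q} - {J}. inv_factor J h ^ (M - e h)) * K J) $ (M - 1 - e J) else 0) =
      (expansion J P * (\<Prod>h\<in>{1..q} - {J}. inv_factor J h ^ m h) * K J) $ (m J - 1)" by simp
  qed simp
  finally show ?thesis .
qed

lemma expansion_minus_linear:
  assumes "c = a + \<rho> J" "c \<noteq> 0"
  shows "expansion J [:a, - 1:] = fps_const c * binom_fps (1 / c) (- 1)"
proof -
  have "expansion J [:a, - 1:] = fps_const c - fps_X"
    by (rule fps_ext) (auto simp: expansion_def pcompose_pCons assms coeff_pCons split: nat.split)
  also have "\<dots> = fps_const c * (1 - fps_const (1 / c) * fps_X)"
    using assms(2) by (intro fps_ext) (simp add: right_diff_distrib)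
  finally show ?thesis by (simp only: binom_fps_minus_one)
qed

text \<open>Here \<open>kappa\<close> arises: it collects the constants \<open>ccol\<close> and 1 /
  (\<rho> h - \<rho> J) that normalizing the linear factors to 1 - x X splits off, and the sign of
  the normalization.\<close>

lemma expansion_factor_series:
  assumes J: "J \<in> {1..q}" and c: "\<And>i. i \<in> {1..p} \<Longrightarrow> ccol \<rho> \<xi> i J \<noteq> 0"
  shows "expansion J (- (\<Prod>i=1..p. [:\<xi> i, - 1:] ^ n i)) * (\<Prod>h\<in>{1..q} - {J}. inv_factor J h ^ m h) =
    fps_const (kappa p q \<rho> \<xi> m n J) * factor_series p q \<rho> \<xi> m n J"
proof -
  have "(\<Prod>i=1..p. expansion J [:\<xi> i, - 1:] ^ n i) =
    (\<Prod>i=1..p. fps_const (ccol \<rho> \<xi> i J ^ n i) * binom_fps (1 / ccol \<rho> \<xi> i J) (- real (n i)))"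
    using c by (intro prod.cong refl)
      (simp add: expansion_minus_linear[of "ccol \<rho> \<xi> i J" "\<xi> i" J for i] ccol_def power_mult_distrib binom_fps_power fps_const_power)
  also have "\<dots> = fps_const (\<Prod>i=1..p. ccol \<rho> \<xi> i J ^ n i) * (\<Prod>i=1..p. binom_fps (1 / ccol \<rho> \<xi> i J) (- real (n i)))"
    by (simp only: prod.distrib prod_fps_const)
  finally have 1: "expansion J (\<Prod>i=1..p. [:\<xi> i, - 1:] ^ n i) = \<dots>"
    by (simp only: expansion_prod expansion_power)
  have "(\<Prod>h\<in>{1..q} - {J}. inv_factor J h ^ m h) =
    (\<Prod>h\<in>{1..q} - {J}. fps_const (1 / (\<rho> h - \<rho> J) ^ m h) * binom_fps (xrow \<rho> J h) (real (m h)))"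
    by (intro prod.cong refl)
      (simp add: inv_factor_def power_mult_distrib binom_fps_power fps_const_power xrow_def power_one_over)
  also have "\<dots> = fps_const (1 / (\<Prod>h\<in>{1..q} - {J}. (\<rho> h - \<rho> J) ^ m h)) *
     (\<Prod>h\<in>{1..q} - {J}. binom_fps (xrow \<rho> J h) (real (m h)))"
    by (simp only: prod.distrib prod_fps_const prod_dividef prod.neutral_const)
  finally have 2: "(\<Prod>h\<in>{1..q} - {J}. inv_factor J h ^ m h) = \<dots>" .
  have "expansion J (- P) = fps_const (- 1) * expansion J P" for P
    using expansion_smult[of J "- 1" P] by simp
  moreover have "fps_const (- 1) * (fps_const a * E) * (fps_const (1 / b) * F) = fps_const (- (a / b)) * (E * F)"
    for a b :: real and E F
  proof -
    have "fps_const (- (a / b)) = fps_const (- 1) * fps_const a * fps_const (1 / b)" by simp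
    then show ?thesis by (simp only: mult_ac)
  qed
  ultimately show ?thesis
    by (simp only: 1 2 kappa_def factor_series_def)
qed

lemma component_eq_residue_sum:
  assumes m: "\<And>h. h \<in> {1..q} \<Longrightarrow> m h \<ge> 1"
    and c: "\<And>i h. i \<in> {1..p} \<Longrightarrow> h \<in> {1..q} \<Longrightarrow> \<xi> i + \<rho> h > 0"
    and normalization: "\<And>z. z > z0 \<Longrightarrow>
      (LINT t:{0..}|lborel. exp (- z * t) * linear_form q d \<rho> B t) =
        - ((\<Prod>i=1..p. (\<xi> i - z) ^ n i) / (\<Prod>h=1..q. (z + \<rho> h) powr (d h + real (m h))))"
  shows "poly (B j) y =
    (\<Sum>J=1..q. kappa p q \<rho> \<xi> m n J * (factor_series p q \<rho> \<xi> m n J * K J) $ (m J - 1))"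
proof -
  obtain g where g: "pf_value g (poly (B j) y)" and L: "\<And>z. z > z0 \<Longrightarrow>
      (LINT t:{0..}|lborel. exp (- z * t) * linear_form q d \<rho> B t) = gamma_product z * g z"
    using linear_form_pf_value by blast
  define P where "P = - (\<Prod>i=1..p. [:\<xi> i, - 1:] ^ n i)"
  have "g z * (\<Prod>h=1..q. (z + \<rho> h) ^ m h) = poly P z" if z: "z > z0" for z
  proof -
    define D where "D = (\<Prod>h=1..q. (z + \<rho> h) ^ m h)"
    have D: "D > 0" unfolding D_def using pos[OF z] by (intro prod_pos) auto
    have "(\<Prod>h=1..q. (z + \<rho> h) powr (d h + real (m h))) * gamma_product z = D"
      unfolding gamma_product_def D_def prod.distrib[symmetric]
      using pos[OF z] by (intro prod.cong refl) (simp add: powr_add[symmetric] powr_realpow)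
    then have "(\<Prod>h=1..q. (z + \<rho> h) powr (d h + real (m h))) = D / gamma_product z"
      using gamma_product_pos[OF z] by (simp add: field_simps)
    then have "gamma_product z * g z = gamma_product z * (- (\<Prod>i=1..p. (\<xi> i - z) ^ n i) / D)"
      using normalization[OF z] L[OF z] by (simp add: field_simps)
    then have "g z = - (\<Prod>i=1..p. (\<xi> i - z) ^ n i) / D"
      using gamma_product_pos[OF z] by (simp only: mult_cancel_left) auto
    moreover have "poly P z = - (\<Prod>i=1..p. (\<xi> i - z) ^ n i)" by (simp add: P_def poly_prod)
    ultimately show ?thesis unfolding D_def[symmetric] using D by simp
  qed
  from pf_value_rational[OF g m this]
  have "poly (B j) y = (\<Sum>J=1..q.
     (expansion J P * (\<Prod>h\<in>{1..q} - {J}. inv_factor J h ^ m h) * K J) $ (m J - 1))" by simp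
  also have "\<dots> = (\<Sum>J=1..q. kappa p q \<rho> \<xi> m n J * (factor_series p q \<rho> \<xi> m n J * K J) $ (m J - 1))"
  proof (rule sum.cong)
    fix J assume J: "J \<in> {1..q}"
    have "ccol \<rho> \<xi> i J \<noteq> 0" if "i \<in> {1..p}" for i
      using c[OF that J] by (simp add: ccol_def)
    from expansion_factor_series[OF J this]
    show "(expansion J P * (\<Prod>h\<in>{1..q} - {J}. inv_factor J h ^ m h) * K J) $ (m J - 1) =
      kappa p q \<rho> \<xi> m n J * (factor_series p q \<rho> \<xi> m n J * K J) $ (m J - 1)"
      unfolding P_def by (simp add: mult.assoc)
  qed simp
  finally show ?thesis .
qed

end

section \<open>Terminating sums as coefficients of power series\<close>

lemma sum_square_eq_triangle:
  fixes \<phi> :: "nat \<Rightarrow> nat \<Rightarrow> real"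
  assumes "\<And>i j. i + j > N \<Longrightarrow> \<phi> i j = 0"
  shows "(\<Sum>i\<le>N. \<Sum>j\<le>N. \<phi> i j) = (\<Sum>n\<le>N. \<Sum>i\<le>n. \<phi> i (n - i))"
proof -
  have "(\<Sum>i\<le>N. \<Sum>j\<le>N. \<phi> i j) = (\<Sum>(i, j)\<in>{..N} \<times> {..N}. \<phi> i j)"
    by (rule sum.cartesian_product)
  also have "\<dots> = (\<Sum>(i, j)\<in>{(i, j). i + j \<le> N}. \<phi> i j)"
  proof (rule sum.mono_neutral_right)
    show "\<forall>x\<in>{..N} \<times> {..N} - {(i, j). i + j \<le> N}. (case x of (i, j) \<Rightarrow> \<phi> i j) = 0"
    proof
      fix x assume "x \<in> {..N} \<times> {..N} - {(i, j). i + j \<le> N}"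
      then show "(case x of (i, j) \<Rightarrow> \<phi> i j) = 0"
        using assms[of "fst x" "snd x"] by (auto simp: split_beta)
    qed
  qed auto
  also have "\<dots> = (\<Sum>n\<le>N. \<Sum>i\<le>n. \<phi> i (n - i))"
    by (rule sum.triangle_reindex_eq)
  finally show ?thesis .
qed

text \<open>A weight that sees only the total index, and vanishes beyond N, collapses the sum over a
  square to a Cauchy product.\<close>

lemma sum_fps_mult_weighted:
  fixes f g :: "real fps"
  assumes "\<And>n. n > N \<Longrightarrow> h n = 0"
  shows "(\<Sum>i\<le>N. \<Sum>j\<le>N. f $ i * (g $ j * h (i + j))) = (\<Sum>n\<le>N. (f * g) $ n * h n)"
proof -
  have "(\<Sum>i\<le>N. \<Sum>j\<le>N. f $ i * (g $ j * h (i + j)))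
    = (\<Sum>n\<le>N. \<Sum>i\<le>n. f $ i * (g $ (n - i) * h (i + (n - i))))"
    by (rule sum_square_eq_triangle) (simp add: assms)
  also have "\<dots> = (\<Sum>n\<le>N. (f * g) $ n * h n)"
    by (intro sum.cong refl)
      (simp add: fps_mult_nth sum_distrib_right mult.assoc flip: atMost_atLeast0)
  finally show ?thesis .
qed

definition index_box :: "nat \<Rightarrow> nat \<Rightarrow> nat list set" where
  "index_box N n = {k. length k = n \<and> set k \<subseteq> {..N}}"

lemma finite_index_box: "finite (index_box N n)"
  unfolding index_box_def by (rule finite_subset[OF _ finite_lists_length_eq[of "{..N}" n]]) auto

lemma index_box_0 [simp]: "index_box N 0 = {[]}"
  by (auto simp: index_box_def)

lemma sum_index_box_append:
  "(\<Sum>k\<in>index_box N (m + n). f k) = (\<Sum>k\<in>index_box N m. \<Sum>l\<in>index_box N n. f (k @ l))"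
proof -
  have "(\<Sum>k\<in>index_box N m. \<Sum>l\<in>index_box N n. f (k @ l)) = (\<Sum>(k, l)\<in>index_box N m \<times> index_box N n. f (k @ l))"
    by (rule sum.cartesian_product)
  also have "\<dots> = (\<Sum>k\<in>index_box N (m + n). f k)"
  proof (rule sum.reindex_bij_witness[where j = "\<lambda>(k, l). k @ l" and i = "\<lambda>k. (take m k, drop m k)"])
    fix k assume k: "k \<in> index_box N (m + n)"
    show "(take m k, drop m k) \<in> index_box N m \<times> index_box N n"
      using k set_take_subset[of m k] set_drop_subset[of m k] by (auto simp: index_box_def)
  qed (auto simp: index_box_def)
  finally show ?thesis ..
qed

lemma index_box_1: "index_box N 1 = (\<lambda>i. [i]) ` {..N}"
  by (auto simp: index_box_def length_Suc_conv)

lemma sum_index_box_1: "(\<Sum>k\<in>index_box N 1. f k) = (\<Sum>i\<le>N. f [i])"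
  unfolding index_box_1 by (subst sum.reindex) (auto simp: inj_on_def)

lemma sum_index_box_Suc: "(\<Sum>k\<in>index_box N (Suc n). f k) = (\<Sum>i\<le>N. \<Sum>k\<in>index_box N n. f (i # k))"
  using sum_index_box_append[of f N 1 n] unfolding sum_index_box_1 by simp

lemma sum_index_box_2: "(\<Sum>k\<in>index_box N 2. f k) = (\<Sum>r\<le>N. \<Sum>s\<le>N. f [r, s])"
  by (simp add: numeral_2_eq_2 sum_index_box_Suc)

definition coeff_prod :: "real fps list \<Rightarrow> nat list \<Rightarrow> real" where
  "coeff_prod fs k = prod_list (map2 fps_nth fs k)"

lemma coeff_prod_append:
  "length fs = length k \<Longrightarrow> coeff_prod (fs @ gs) (k @ l) = coeff_prod fs k * coeff_prod gs l"
  by (simp add: coeff_prod_def)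

lemma coeff_prod_conv_prod:
  "length k = length fs \<Longrightarrow> coeff_prod fs k = (\<Prod>\<nu><length fs. (fs ! \<nu>) $ (k ! \<nu>))"
proof (induction fs arbitrary: k)
  case (Cons f fs)
  then obtain i k' where "k = i # k'" by (cases k) auto
  with Cons show ?case by (simp add: coeff_prod_def prod.lessThan_Suc_shift del: prod.lessThan_Suc)
qed (simp add: coeff_prod_def)

lemma sum_index_box_coeff_prod:
  assumes "\<And>n. n > N \<Longrightarrow> h n = 0"
  shows "(\<Sum>k\<in>index_box N (length fs). coeff_prod fs k * h (sum_list k)) = (\<Sum>n\<le>N. prod_list fs $ n * h n)"
  using assms
proof (induction fs arbitrary: h)
  case Nil
  have "(\<Sum>n\<le>N. (1 :: real fps) $ n * h n) = (\<Sum>n\<le>N. if n = 0 then h 0 else 0)"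
    by (intro sum.cong) auto
  then show ?case by (simp add: coeff_prod_def)
next
  case (Cons f fs)
  have "(\<Sum>k\<in>index_box N (length (f # fs)). coeff_prod (f # fs) k * h (sum_list k)) =
    (\<Sum>i\<le>N. f $ i * (\<Sum>k\<in>index_box N (length fs). coeff_prod fs k * h (i + sum_list k)))"
    by (simp add: sum_index_box_Suc coeff_prod_def sum_distrib_left mult.assoc)
  also have "\<dots> = (\<Sum>i\<le>N. f $ i * (\<Sum>j\<le>N. prod_list fs $ j * h (i + j)))"
    using Cons.prems by (subst Cons.IH) auto
  also have "\<dots> = (\<Sum>n\<le>N. (f * prod_list fs) $ n * h n)"
    unfolding sum_distrib_left by (rule sum_fps_mult_weighted) (rule Cons.prems)
  finally show ?case by simp
qed

text \<open>The shared parameters see the indices only through |beta| + r + s and |beta| + s. In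
  this twisted Cauchy product t stands for the former and b for the latter.\<close>

definition weighted_conv :: "(nat \<Rightarrow> nat \<Rightarrow> real) \<Rightarrow> real fps \<Rightarrow> real fps \<Rightarrow> real fps" where
  "weighted_conv W g f = Abs_fps (\<lambda>t. \<Sum>b\<le>t. g $ b * f $ (t - b) * W t b)"

text \<open>The groups of indices play different roles: beta and s enter both arguments of
  \<open>W\<close> and merge into one series, r enters the first only and is joined by
  \<open>weighted_conv\<close>, and eta enters \<open>\<tau>\<close> only and gives an ordinary
  product.\<close>

lemma sum_index_box_weighted:
  assumes \<tau>: "\<And>n. n > N \<Longrightarrow> \<tau> n = 0"
  shows "(\<Sum>\<eta>\<in>index_box N (length fs). \<Sum>\<beta>\<in>index_box N (length gs). \<Sum>r\<le>N. \<Sum>s\<le>N.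
      coeff_prod fs \<eta> * (coeff_prod gs \<beta> * (f $ r * (g $ s *
        (W (sum_list \<beta> + r + s) (sum_list \<beta> + s) * \<tau> (sum_list \<eta> + (sum_list \<beta> + r + s)))))))
    = (\<Sum>n\<le>N. (prod_list fs * weighted_conv W (prod_list gs * g) f) $ n * \<tau> n)"
proof -
  define h3 where "h3 e b = (\<Sum>r\<le>N. f $ r * (W (b + r) b * \<tau> (e + (b + r))))" for e b
  define h2 where "h2 e c = (\<Sum>s\<le>N. g $ s * h3 e (c + s))" for e c
  define h1 where "h1 e = (\<Sum>\<beta>\<in>index_box N (length gs). coeff_prod gs \<beta> * h2 e (sum_list \<beta>))" for e
  define G where "G = weighted_conv W (prod_list gs * g) f"
  have h3: "h3 e b = 0" if "b > N \<or> e > N" for e b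
    unfolding h3_def using that by (intro sum.neutral) (auto simp: \<tau>)
  have h2: "h2 e c = 0" if "c > N \<or> e > N" for e c
    unfolding h2_def using that by (intro sum.neutral) (auto simp: h3)
  have h1: "h1 e = 0" if "e > N" for e
    unfolding h1_def using that by (intro sum.neutral) (auto simp: h2)
  have "h2 e c = (\<Sum>r\<le>N. \<Sum>s\<le>N. f $ r * (g $ s * (W (c + r + s) (c + s) * \<tau> (e + (c + r + s)))))" for e c
    unfolding h2_def h3_def sum_distrib_left
    by (subst sum.swap) (intro sum.cong refl, simp add: mult_ac add_ac)
  then have "(\<Sum>\<eta>\<in>index_box N (length fs). \<Sum>\<beta>\<in>index_box N (length gs). \<Sum>r\<le>N. \<Sum>s\<le>N.
      coeff_prod fs \<eta> * (coeff_prod gs \<beta> * (f $ r * (g $ s *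
        (W (sum_list \<beta> + r + s) (sum_list \<beta> + s) * \<tau> (sum_list \<eta> + (sum_list \<beta> + r + s)))))))
    = (\<Sum>\<eta>\<in>index_box N (length fs). coeff_prod fs \<eta> * h1 (sum_list \<eta>))"
    unfolding h1_def by (simp only: sum_distrib_left)
  also have "\<dots> = (\<Sum>e\<le>N. prod_list fs $ e * h1 e)"
    by (rule sum_index_box_coeff_prod) (rule h1)
  also have "\<dots> = (\<Sum>e\<le>N. prod_list fs $ e * (\<Sum>t\<le>N. G $ t * \<tau> (e + t)))"
  proof (intro sum.cong refl arg_cong2[where f = "(*)"])
    fix e
    have "h1 e = (\<Sum>c\<le>N. prod_list gs $ c * h2 e c)"
      unfolding h1_def by (rule sum_index_box_coeff_prod) (simp add: h2)
    also have "\<dots> = (\<Sum>b\<le>N. (prod_list gs * g) $ b * h3 e b)"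
      unfolding h2_def sum_distrib_left by (rule sum_fps_mult_weighted) (simp add: h3)
    also have "\<dots> = (\<Sum>b\<le>N. \<Sum>r\<le>N. (prod_list gs * g) $ b * (f $ r * (W (b + r) b * \<tau> (e + (b + r)))))"
      unfolding h3_def sum_distrib_left ..
    also have "\<dots> = (\<Sum>t\<le>N. \<Sum>b\<le>t. (prod_list gs * g) $ b *
        (f $ (t - b) * (W (b + (t - b)) b * \<tau> (e + (b + (t - b))))))"
      by (rule sum_square_eq_triangle) (simp add: \<tau>)
    also have "\<dots> = (\<Sum>t\<le>N. G $ t * \<tau> (e + t))"
      by (intro sum.cong refl) (simp add: G_def weighted_conv_def sum_distrib_right mult.assoc)
    finally show "h1 e = (\<Sum>t\<le>N. G $ t * \<tau> (e + t))" .
  qed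
  also have "\<dots> = (\<Sum>n\<le>N. (prod_list fs * G) $ n * \<tau> n)"
    unfolding sum_distrib_left by (rule sum_fps_mult_weighted) (rule \<tau>)
  finally show ?thesis by (simp only: G_def)
qed

definition shared_ratio :: "real \<Rightarrow> real \<Rightarrow> nat \<Rightarrow> nat \<Rightarrow> real" where
  "shared_ratio a d t b = pochhammer (a + d + 1) t * pochhammer (a + 1) b /
     (pochhammer (a + 2) t * pochhammer (a + d + 1) b)"

text \<open>Both sides have constant coefficient \<open>g $ 0\<close> and obey (t + a + 2) c(t+1) =
  x (a + d + 1 + t) c(t) + (a + 1) g(t+1). On the left, passing from t to t + 1 multiplies the ratio
  by (a + d + 1 + t) / (a + 2 + t), and on the diagonal b = t it equals (a + 1) / (a + 1 + t). On
  the right the recurrence comes from the equation of \<open>weighted_int\<close>.\<close>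

lemma weighted_conv_shared_ratio:
  assumes a: "a > -1" and d: "d > 0"
  shows "weighted_conv (shared_ratio a d) g (binom_fps x 1) =
    fps_const (a + 1) * (binom_fps x d * weighted_int a (binom_fps x (1 - d) * g))"
proof -
  define G where "G = weighted_conv (shared_ratio a d) g (binom_fps x 1)"
  define W where "W = weighted_int a (binom_fps x (1 - d) * g)"
  define T where "T = binom_fps x d * W"
  \<comment> \<open>The operator X d/dX + (a + 1) undoes \<open>weighted_int a\<close>, and
    multiplication by 1 - x X then removes the remaining binomial series.\<close>
  define Y where "Y = fps_X * fps_deriv T + fps_const (a + 1) * T"
  have W: "fps_X * fps_deriv W + fps_const (a + 1) * W = binom_fps x (1 - d) * g"
    unfolding W_def using a by (rule weighted_int_ode)
  have Y_nth: "Y $ n = (real n + a + 1) * T $ n" for n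
    by (cases n) (simp_all add: Y_def algebra_simps)
  have "Y = fps_const (d * x) * binom_fps x 1 * (fps_X * T) +
     binom_fps x d * (fps_X * fps_deriv W + fps_const (a + 1) * W)"
    unfolding Y_def T_def by (simp only: fps_deriv_mult fps_deriv_binom_fps distrib_left mult_ac add_ac)
  also have "binom_fps x d * (fps_X * fps_deriv W + fps_const (a + 1) * W) = binom_fps x 1 * g"
    unfolding W mult.assoc[symmetric] by (simp flip: binom_fps_add)
  finally have "(1 - fps_const x * fps_X) * Y =
     ((1 - fps_const x * fps_X) * binom_fps x 1) * (fps_const (d * x) * (fps_X * T) + g)"
    by (simp only: distrib_left mult_ac)
  then have ode: "(1 - fps_const x * fps_X) * Y = fps_const (d * x) * (fps_X * T) + g"
    by (simp only: binom_fps_one_cancel mult_1)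
  have Y_shift: "((1 - fps_const x * fps_X) * Y) $ n = Y $ n - x * (if n = 0 then 0 else Y $ (n - 1))" for n
    by (simp add: left_diff_distrib mult.assoc)
  have T0: "(a + 1) * T $ 0 = g $ 0"
    using arg_cong[OF ode, of "\<lambda>f. f $ 0"] unfolding Y_shift Y_nth by simp
  have TS: "(real t + a + 2) * T $ Suc t = x * (a + d + 1 + real t) * T $ t + g $ Suc t" for t
    using arg_cong[OF ode, of "\<lambda>f. f $ Suc t"] unfolding Y_shift Y_nth by (simp add: algebra_simps)
  have pos2: "pochhammer (a + 2) t > 0" "pochhammer (a + 1) t > 0" "pochhammer (a + d + 1) t > 0" for t
    using a d by (auto intro!: pochhammer_pos)
  have Wtt: "shared_ratio a d t t * (a + 1 + real t) = a + 1" for t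
  proof -
    have "pochhammer (a + 1) (Suc t) = (a + 1) * pochhammer (a + 2) t"
      by (simp add: pochhammer_rec add.assoc)
    then have "pochhammer (a + 1) t * (a + 1 + real t) = (a + 1) * pochhammer (a + 2) t"
      by (simp add: pochhammer_Suc)
    then show ?thesis using pos2[of t] by (simp add: shared_ratio_def field_simps)
  qed
  have WS: "shared_ratio a d (Suc t) b * (a + 2 + real t) = shared_ratio a d t b * (a + d + 1 + real t)" for t b
  proof -
    have "a + 2 + real t > 0" using a by simp
    then show ?thesis by (simp add: shared_ratio_def pochhammer_Suc)
  qed
  have bin: "binom_fps x 1 $ l = x ^ l" for l by (simp add: pochhammer_fact[symmetric])
  have G_nth: "G $ t = (\<Sum>b\<le>t. g $ b * x ^ (t - b) * shared_ratio a d t b)" for t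
    by (simp add: G_def weighted_conv_def bin del: binom_fps_nth)
  have GS: "(real t + a + 2) * G $ Suc t = x * (a + d + 1 + real t) * G $ t + (a + 1) * g $ Suc t" for t
  proof -
    have "(real t + a + 2) * G $ Suc t =
      (\<Sum>b\<le>t. g $ b * x ^ (Suc t - b) * (shared_ratio a d (Suc t) b * (a + 2 + real t)))
      + g $ Suc t * (shared_ratio a d (Suc t) (Suc t) * (a + 1 + real (Suc t)))"
      by (simp add: G_nth sum_distrib_left distrib_left mult_ac add_ac)
    also have "\<dots> = (\<Sum>b\<le>t. g $ b * x ^ (Suc t - b) * (shared_ratio a d t b * (a + d + 1 + real t)))
      + g $ Suc t * (a + 1)"
      unfolding WS Wtt ..
    also have "(\<Sum>b\<le>t. g $ b * x ^ (Suc t - b) * (shared_ratio a d t b * (a + d + 1 + real t)))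
      = x * (a + d + 1 + real t) * G $ t"
      unfolding G_nth sum_distrib_left by (intro sum.cong refl) (simp add: Suc_diff_le)
    finally show ?thesis by (simp only: mult.commute)
  qed
  have "G $ n = (a + 1) * T $ n" for n
  proof (induction n)
    case 0
    show ?case using T0 by (simp add: G_nth shared_ratio_def)
  next
    case (Suc t)
    have "(real t + a + 2) * G $ Suc t = (real t + a + 2) * ((a + 1) * T $ Suc t)"
      unfolding GS Suc mult.left_commute[of "real t + a + 2" "a + 1"] TS by (simp add: algebra_simps)
    moreover have "real t + a + 2 \<noteq> 0" using a by simp
    ultimately show ?case by simp
  qed
  then show ?thesis by (intro fps_ext) (simp add: G_def T_def W_def)
qed

section \<open>The terms of the Srivastava--Daoust sums as products of coefficients\<close>

lemma dot_append: "length w = length k \<Longrightarrow> dot (w @ w') (k @ k') = dot w k + dot w' k'"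
  by (simp add: dot_def)

lemma dot_replicate: "length k = n \<Longrightarrow> dot (replicate n c) k = c * sum_list k"
  by (induction k arbitrary: n) (auto simp: dot_def distrib_left)

lemma dot_Cons [simp]: "dot (w # ws) (k # ks) = w * k + dot ws ks"
  and dot_Nil [simp]: "dot [] [] = 0"
  by (simp_all add: dot_def)

definition degree_weight :: "nat \<Rightarrow> real \<Rightarrow> nat \<Rightarrow> real" where
  "degree_weight N y n = y ^ N / fact N * pochhammer (- real N) n * (- 1 / y) ^ n"

text \<open>The prefactor, the terminating parameter -N and the powers of -1/y together form a
  coefficient of exp (y X). Summing against this weight therefore means taking coefficient N of a
  product with that series.\<close>

lemma degree_weight_eq:
  assumes "y \<noteq> 0"
  shows "degree_weight N y n = (if n \<le> N then fps_exp y $ (N - n) else 0)"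
proof (cases "n \<le> N")
  case True
  have "pochhammer (- real N) n = (- 1) ^ n * pochhammer (real N - real n + 1) n"
    by (rule pochhammer_minus)
  also have "pochhammer (real N - real n + 1) n = fact N / fact (N - n)"
  proof -
    have "real N - real n + 1 = 1 + real (N - n)" using True by simp
    moreover have "pochhammer (1 :: real) ((N - n) + n) = pochhammer 1 (N - n) * pochhammer (1 + real (N - n)) n"
      by (rule pochhammer_product')
    ultimately show ?thesis using True by (simp add: pochhammer_fact[symmetric] field_simps)
  qed
  finally have "degree_weight N y n = y ^ N * ((- 1) ^ n * (- 1 / y) ^ n) / fact (N - n)"
    by (simp add: degree_weight_def)
  also have "(- 1) ^ n * (- 1 / y) ^ n = 1 / y ^ n"
    by (simp flip: power_mult_distrib) (simp add: power_one_over)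
  also have "y ^ N * (1 / y ^ n) = y ^ (N - n)" using True assms by (simp add: power_diff)
  finally show ?thesis using True by simp
next
  case False
  then show ?thesis by (simp add: degree_weight_def pochhammer_of_nat_eq_0_lemma)
qed

definition V_col_series :: "nat \<Rightarrow> nat \<Rightarrow> (nat \<Rightarrow> real) \<Rightarrow> (nat \<Rightarrow> real) \<Rightarrow> (nat \<Rightarrow> real) \<Rightarrow>
    (nat \<Rightarrow> nat) \<Rightarrow> (nat \<Rightarrow> nat) \<Rightarrow> nat \<Rightarrow> nat \<Rightarrow> real fps list" where
  "V_col_series p q d \<rho> \<xi> m n J j =
     map (\<lambda>i. binom_fps (1 / ccol \<rho> \<xi> i J) (- real (n i))) [1..<p+1] @
     map (\<lambda>h. binom_fps (xrow \<rho> J h) (mtilde d m j h)) (rows_except q {J})"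

definition V_row_series :: "nat \<Rightarrow> (nat \<Rightarrow> real) \<Rightarrow> (nat \<Rightarrow> real) \<Rightarrow> nat \<Rightarrow> nat \<Rightarrow> real fps list" where
  "V_row_series q d \<rho> J j = map (\<lambda>h. binom_fps (xrow \<rho> J h) (- d h)) (rows_except q {J, j})"

text \<open>Each argument but the last contains -1/y. The last one is 1 = (-y) (-1/y) and has no
  parameter, so it contributes exp (-y X); then (-1/y) to the total index splits off
  uniformly.\<close>

lemma V_individual_factors:
  fixes \<rho> \<xi> :: "nat \<Rightarrow> real"
  assumes Jj: "J \<in> {1..q}" "j \<in> {1..q}" "J \<noteq> j" and y: "y \<noteq> 0" and k: "length k = p + 2 * q - 1"
  defines "z \<equiv> V_args p q \<rho> \<xi> J j y"
  shows "(\<Prod>\<nu><length z. (\<Prod>(b, w)\<leftarrow>V_indiv p q d m n J j ! \<nu>. pochhammer b (w * k ! \<nu>)) /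
        (\<Prod>(b, w)\<leftarrow>V_indiv_lower p q ! \<nu>. pochhammer b (w * k ! \<nu>)) *
        ((z ! \<nu>) ^ (k ! \<nu>) / fact (k ! \<nu>))) =
    coeff_prod (V_col_series p q d \<rho> \<xi> m n J j @ V_row_series q d \<rho> J j @
       [binom_fps (xrow \<rho> J j) 1, fps_exp (- y)]) k * (- 1 / y) ^ sum_list k"
proof -
  \<comment> \<open>One list of triples of parameter, argument and power series, so that the block
    structure is inspected only once.\<close>
  define L :: "((real \<times> nat) list \<times> real \<times> real fps) list" where "L =
    map (\<lambda>i. ([(- real (n i), 1)], - 1 / (ccol \<rho> \<xi> i J * y), binom_fps (1 / ccol \<rho> \<xi> i J) (- real (n i)))) [1..<p+1] @
    map (\<lambda>h. ([(mtilde d m j h, 1)], - xrow \<rho> J h / y, binom_fps (xrow \<rho> J h) (mtilde d m j h))) (rows_except q {J}) @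
    map (\<lambda>h. ([(- d h, 1)], - xrow \<rho> J h / y, binom_fps (xrow \<rho> J h) (- d h))) (rows_except q {J, j}) @
    [([(1, 1)], - xrow \<rho> J j / y, binom_fps (xrow \<rho> J j) 1), ([], 1, fps_exp (- y))]"
  have indiv: "V_indiv p q d m n J j = map fst L"
    by (simp add: L_def V_indiv_def V_b_def comp_def del: upt_Suc)
  have z: "z = map (fst \<circ> snd) L"
    by (simp add: L_def z_def V_args_def comp_def del: upt_Suc)
  have series: "V_col_series p q d \<rho> \<xi> m n J j @ V_row_series q d \<rho> J j @
       [binom_fps (xrow \<rho> J j) 1, fps_exp (- y)] = map (snd \<circ> snd) L"
    by (simp add: L_def V_col_series_def V_row_series_def comp_def del: upt_Suc)
  have len: "length L = p + 2 * q - 1"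
    using length_V_args[OF Jj, of p \<rho> \<xi> y] by (simp add: z_def[symmetric] z)
  have *: "(\<Prod>(b, w)\<leftarrow>iu. pochhammer b (w * i)) * (v ^ i / fact i) = f $ i * (- 1 / y) ^ i"
    if "(iu, v, f) \<in> set L" for iu v f i
  proof -
    have bin: "(\<Prod>(b, w)\<leftarrow>[(b, 1)]. pochhammer b (w * i)) * (v ^ i / fact i) =
        binom_fps x b $ i * (- 1 / y) ^ i" if "v = x * (- 1 / y)" for b x v
      unfolding that power_mult_distrib by simp
    have ex: "(\<Prod>(b, w)\<leftarrow>[]. pochhammer (b::real) (w * i)) * (1 ^ i / fact i) =
        fps_exp (- y) $ i * (- 1 / y) ^ i"
      using y by (simp flip: power_mult_distrib)
    from that consider
      i' where "iu = [(- real (n i'), 1)]" "v = - 1 / (ccol \<rho> \<xi> i' J * y)"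
        "f = binom_fps (1 / ccol \<rho> \<xi> i' J) (- real (n i'))"
      | b h where "iu = [(b, 1)]" "v = - xrow \<rho> J h / y" "f = binom_fps (xrow \<rho> J h) b"
      | "iu = []" "v = 1" "f = fps_exp (- y)"
      unfolding L_def by auto
    then show ?thesis
    proof cases
      case (1 i')
      show ?thesis unfolding 1 by (rule bin) simp
    next
      case (2 b h)
      show ?thesis unfolding 2 by (rule bin) simp
    next
      case 3
      show ?thesis unfolding 3 by (rule ex)
    qed
  qed
  have "(\<Prod>\<nu><length z. (\<Prod>(b, w)\<leftarrow>V_indiv p q d m n J j ! \<nu>. pochhammer b (w * k ! \<nu>)) /
        (\<Prod>(b, w)\<leftarrow>V_indiv_lower p q ! \<nu>. pochhammer b (w * k ! \<nu>)) *
        ((z ! \<nu>) ^ (k ! \<nu>) / fact (k ! \<nu>)))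
    = (\<Prod>\<nu><length L. (map (snd \<circ> snd) L ! \<nu>) $ (k ! \<nu>) * (- 1 / y) ^ (k ! \<nu>))"
  proof (rule prod.cong)
    fix \<nu> assume "\<nu> \<in> {..<length L}"
    then have \<nu>: "\<nu> < length L" by simp
    obtain iu v f where L: "L ! \<nu> = (iu, v, f)" by (cases "L ! \<nu>") auto
    have "(iu, v, f) \<in> set L" using \<nu> L by (metis nth_mem)
    from *[OF this, of "k ! \<nu>"] show "(\<Prod>(b, w)\<leftarrow>V_indiv p q d m n J j ! \<nu>. pochhammer b (w * k ! \<nu>)) /
        (\<Prod>(b, w)\<leftarrow>V_indiv_lower p q ! \<nu>. pochhammer b (w * k ! \<nu>)) *
        ((z ! \<nu>) ^ (k ! \<nu>) / fact (k ! \<nu>)) = (map (snd \<circ> snd) L ! \<nu>) $ (k ! \<nu>) * (- 1 / y) ^ (k ! \<nu>)"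
      using \<nu> L len by (simp add: indiv z V_indiv_lower_def)
  qed (simp add: z)
  also have "\<dots> = coeff_prod (map (snd \<circ> snd) L) k * (- 1 / y) ^ (\<Sum>\<nu><length L. k ! \<nu>)"
    using k len by (subst coeff_prod_conv_prod) (simp_all add: prod.distrib power_sum)
  also have "(\<Sum>\<nu><length L. k ! \<nu>) = sum_list k"
    using k len by (simp add: sum_list_sum_nth atLeast0LessThan)
  finally show ?thesis unfolding series .
qed

lemma V_sd_term:
  assumes Jj: "J \<in> {1..q}" "j \<in> {1..q}" "J \<noteq> j" and y: "y \<noteq> 0"
    and \<eta>: "length \<eta> = r0 p q" and \<beta>: "length \<beta> = t0 q"
  shows "y ^ N / fact N * sd_term (V_upper p q d j N a) (V_lower p q d j a) (V_indiv p q d m n J j)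
      (V_indiv_lower p q) (V_args p q \<rho> \<xi> J j y) (\<eta> @ \<beta> @ [r, s]) =
    coeff_prod (V_col_series p q d \<rho> \<xi> m n J j) \<eta> * (coeff_prod (V_row_series q d \<rho> J j) \<beta> *
      (binom_fps (xrow \<rho> J j) 1 $ r * (fps_exp (- y) $ s *
        (shared_ratio a (d j) (sum_list \<beta> + r + s) (sum_list \<beta> + s) *
          degree_weight N y (sum_list \<eta> + (sum_list \<beta> + r + s))))))"
proof -
  define k where "k = \<eta> @ \<beta> @ [r, s]"
  have q: "q \<ge> 2" using Jj by auto
  have k: "length k = p + 2 * q - 1" using \<eta> \<beta> q by (simp add: k_def r0_def t0_def)
  have len: "length (V_col_series p q d \<rho> \<xi> m n J j) = length \<eta>"
    "length (V_row_series q d \<rho> J j) = length \<beta>"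
    using \<eta> \<beta> q length_rows_except[OF Jj]
    by (simp_all add: V_col_series_def V_row_series_def r0_def t0_def del: upt_Suc)
  have dots: "dot (vec_e p q) k = sum_list \<eta> + (sum_list \<beta> + r + s)"
    "dot (vec_u p q) k = sum_list \<beta> + r + s" "dot (vec_v p q) k = sum_list \<beta> + s"
    by (simp_all add: k_def vec_e_def vec_u_def vec_v_def dot_append dot_replicate \<eta> \<beta>)
  have up: "(\<Prod>(a, w)\<leftarrow>V_upper p q d j N a. pochhammer a (dot w k)) /
      (\<Prod>(a, w)\<leftarrow>V_lower p q d j a. pochhammer a (dot w k)) =
    pochhammer (- real N) (sum_list \<eta> + (sum_list \<beta> + r + s)) *
      shared_ratio a (d j) (sum_list \<beta> + r + s) (sum_list \<beta> + s)"
    by (simp add: V_upper_def V_lower_def dots shared_ratio_def)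
  have sum_k: "sum_list k = sum_list \<eta> + (sum_list \<beta> + r + s)" by (simp add: k_def)
  have cp: "coeff_prod (V_col_series p q d \<rho> \<xi> m n J j @ V_row_series q d \<rho> J j @
       [binom_fps (xrow \<rho> J j) 1, fps_exp (- y)]) k =
    coeff_prod (V_col_series p q d \<rho> \<xi> m n J j) \<eta> * (coeff_prod (V_row_series q d \<rho> J j) \<beta> *
      (binom_fps (xrow \<rho> J j) 1 $ r * fps_exp (- y) $ s))"
    unfolding k_def coeff_prod_append[OF len(1)] coeff_prod_append[OF len(2)]
    by (simp add: coeff_prod_def)
  show ?thesis
    unfolding k_def[symmetric] sd_term_def up V_individual_factors[OF Jj y k] cp sum_k degree_weight_def
    by (simp only: mult_ac)
qed

lemma prod_list_rows_except: "(\<Prod>h\<leftarrow>rows_except q S. f h) = (\<Prod>h\<in>{1..q} - S. f h)"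
  for f :: "nat \<Rightarrow> 'a :: comm_monoid_mult"
proof -
  have "distinct (rows_except q S)" "set (rows_except q S) = {1..q} - S"
    by (auto simp: rows_except_def)
  then show ?thesis by (metis prod.distinct_set_conv_list)
qed

text \<open>The special treatment of row j in the parameters is compensated by
  \<open>weighted_conv_shared_ratio\<close>. Its factor with exponent \<open>d j\<close> supplies
  what \<open>mtilde\<close> omits at row j, so that eta yields \<open>factor_series\<close> and the
  binomial part of \<open>row_series\<close>. Its factor with exponent \<open>1 - d j\<close>
  supplies the row missing from beta together with the extra series of exponent 1. The exponential
  of \<open>row_series\<close> comes from \<open>degree_weight\<close>.\<close>

lemma V_sd_eq_fps_nth:
  assumes Jj: "J \<in> {1..q}" "j \<in> {1..q}" "J \<noteq> j" and y: "y \<noteq> 0" and a: "a > -1" and d: "d j > 0"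
  shows "y ^ N / fact N * V_sd p q d \<rho> \<xi> m n J j N a y =
    (a + 1) * (factor_series p q \<rho> \<xi> m n J * (row_series q d \<rho> y J *
      weighted_int a (row_series_inv q d \<rho> y J * binom_fps (xrow \<rho> J j) 1))) $ N"
proof -
  define R where "R = p + 2 * q - 1"
  define z where "z = V_args p q \<rho> \<xi> J j y"
  define T where "T k = sd_term (V_upper p q d j N a) (V_lower p q d j a) (V_indiv p q d m n J j)
            (V_indiv_lower p q) z k" for k
  define x where "x = xrow \<rho> J j"
  define A where "A = V_col_series p q d \<rho> \<xi> m n J j"
  define C where "C = V_row_series q d \<rho> J j"
  define G where "G = weighted_int a (row_series_inv q d \<rho> y J * binom_fps x 1)"
  have q: "q \<ge> 2" using Jj by auto
  have R: "R = r0 p q + (t0 q + 2)" using q by (simp add: R_def r0_def t0_def)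
  have len: "length A = r0 p q" "length C = t0 q"
    using q length_rows_except[OF Jj]
    by (simp_all add: A_def C_def V_col_series_def V_row_series_def r0_def t0_def del: upt_Suc)
  have "V_sd p q d \<rho> \<xi> m n J j N a y = (\<Sum>\<^sub>\<infinity>k\<in>{k. length k = R}. T k)"
    by (simp add: V_sd_def srivastava_daoust_def length_V_args[OF Jj] R_def T_def z_def)
  also have "\<dots> = (\<Sum>\<^sub>\<infinity>k\<in>index_box N R. T k)"
  proof (rule infsum_cong_neutral)
    fix k assume k: "k \<in> {k. length k = R} - index_box N R"
    then have "\<not> set k \<subseteq> {..N}" by (simp add: index_box_def)
    then obtain i where "i \<in> set k" "i > N" by (auto simp: subset_iff)
    then have "sum_list k > N" using member_le_sum_list[of i k] by linarith
    then show "T k = 0" using k unfolding T_def R_def by (intro sd_term_V_eq_0[OF Jj]) auto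
  qed (auto simp: index_box_def)
  also have "\<dots> = (\<Sum>k\<in>index_box N R. T k)" by (simp add: finite_index_box)
  also have "\<dots> = (\<Sum>\<eta>\<in>index_box N (length A). \<Sum>\<beta>\<in>index_box N (length C). \<Sum>r\<le>N. \<Sum>s\<le>N. T (\<eta> @ \<beta> @ [r, s]))"
    unfolding R sum_index_box_append sum_index_box_2 len by simp
  finally have "y ^ N / fact N * V_sd p q d \<rho> \<xi> m n J j N a y =
    (\<Sum>\<eta>\<in>index_box N (length A). \<Sum>\<beta>\<in>index_box N (length C). \<Sum>r\<le>N. \<Sum>s\<le>N.
      y ^ N / fact N * T (\<eta> @ \<beta> @ [r, s]))"
    by (simp only: sum_distrib_left)
  also have "\<dots> = (\<Sum>\<eta>\<in>index_box N (length A). \<Sum>\<beta>\<in>index_box N (length C). \<Sum>r\<le>N. \<Sum>s\<le>N.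
      coeff_prod A \<eta> * (coeff_prod C \<beta> * (binom_fps x 1 $ r * (fps_exp (- y) $ s *
        (shared_ratio a (d j) (sum_list \<beta> + r + s) (sum_list \<beta> + s) *
          degree_weight N y (sum_list \<eta> + (sum_list \<beta> + r + s)))))))"
    unfolding T_def z_def A_def[symmetric] C_def[symmetric] x_def
  proof (intro sum.cong refl)
    fix \<eta> \<beta> r s assume "\<eta> \<in> index_box N (length A)" "\<beta> \<in> index_box N (length C)"
    then have "length \<eta> = r0 p q" "length \<beta> = t0 q" by (auto simp: index_box_def len)
    from V_sd_term[OF Jj y this]
    show "y ^ N / fact N * sd_term (V_upper p q d j N a) (V_lower p q d j a) (V_indiv p q d m n J j)
            (V_indiv_lower p q) (V_args p q \<rho> \<xi> J j y) (\<eta> @ \<beta> @ [r, s]) =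
      coeff_prod A \<eta> * (coeff_prod C \<beta> * (binom_fps (xrow \<rho> J j) 1 $ r * (fps_exp (- y) $ s *
        (shared_ratio a (d j) (sum_list \<beta> + r + s) (sum_list \<beta> + s) *
          degree_weight N y (sum_list \<eta> + (sum_list \<beta> + r + s))))))"
      unfolding A_def C_def .
  qed
  also have "\<dots> = (\<Sum>n\<le>N. (prod_list A * weighted_conv (shared_ratio a (d j)) (prod_list C * fps_exp (- y))
      (binom_fps x 1)) $ n * degree_weight N y n)"
    by (rule sum_index_box_weighted) (simp add: degree_weight_eq[OF y])
  also have "\<dots> = (prod_list A * weighted_conv (shared_ratio a (d j)) (prod_list C * fps_exp (- y))
      (binom_fps x 1) * fps_exp y) $ N"
    unfolding fps_mult_nth[of _ "fps_exp y"] by (intro sum.cong) (auto simp: degree_weight_eq[OF y])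
  also have "weighted_conv (shared_ratio a (d j)) (prod_list C * fps_exp (- y)) (binom_fps x 1) =
      fps_const (a + 1) * (binom_fps x (d j) * G)"
  proof -
    have "binom_fps x (1 - d j) = binom_fps x 1 * binom_fps x (- d j)"
      by (simp flip: binom_fps_add)
    moreover have "row_series_inv q d \<rho> y J = fps_exp (- y) * (binom_fps x (- d j) * prod_list C)"
    proof -
      have "{1..q} - {J} - {j} = {1..q} - {J, j}" by auto
      then show ?thesis
        unfolding row_series_inv_def C_def V_row_series_def prod_list_rows_except x_def
        using Jj by (subst prod.remove[of _ j]) auto
    qed
    ultimately have "binom_fps x (1 - d j) * (prod_list C * fps_exp (- y)) =
      row_series_inv q d \<rho> y J * binom_fps x 1"
      by (simp only: mult_ac)
    then show ?thesis
      unfolding weighted_conv_shared_ratio[OF a d] G_def by simp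
  qed
  also have "prod_list A * (fps_const (a + 1) * (binom_fps x (d j) * G)) * fps_exp y =
    fps_const (a + 1) * (factor_series p q \<rho> \<xi> m n J * (row_series q d \<rho> y J * G))"
  proof -
    define E where "E = (\<Prod>i=1..p. binom_fps (1 / ccol \<rho> \<xi> i J) (- real (n i)))"
    have "prod_list (map (\<lambda>i. binom_fps (1 / ccol \<rho> \<xi> i J) (- real (n i))) [1..<p+1]) = E"
      unfolding E_def by (subst prod.distinct_set_conv_list[symmetric])
        (simp_all add: atLeastLessThanSuc_atLeastAtMost del: upt_Suc)
    then have A: "prod_list A = E * (\<Prod>h\<in>{1..q} - {J}. binom_fps (xrow \<rho> J h) (mtilde d m j h))"
      by (simp only: A_def V_col_series_def prod_list.append prod_list_rows_except)
    have "(\<Prod>h\<in>{1..q} - {J}. binom_fps (xrow \<rho> J h) (mtilde d m j h)) * binom_fps x (d j)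
      = binom_fps x (d j) * (binom_fps x (real (m j)) *
        (\<Prod>h\<in>{1..q} - {J} - {j}. binom_fps (xrow \<rho> J h) (real (m h) + d h)))"
      using Jj by (subst prod.remove[of _ j]) (auto simp: mtilde_def x_def mult_ac intro!: prod.cong)
    also have "\<dots> = (\<Prod>h\<in>{1..q} - {J}. binom_fps (xrow \<rho> J h) (real (m h) + d h))"
      using Jj by (subst (2) prod.remove[of _ j]) (auto simp: x_def binom_fps_add mult_ac)
    also have "\<dots> = (\<Prod>h\<in>{1..q} - {J}. binom_fps (xrow \<rho> J h) (real (m h))) *
      (\<Prod>h\<in>{1..q} - {J}. binom_fps (xrow \<rho> J h) (d h))"
      by (simp only: binom_fps_add prod.distrib)
    finally have B: "(\<Prod>h\<in>{1..q} - {J}. binom_fps (xrow \<rho> J h) (mtilde d m j h)) * binom_fps x (d j) = \<dots>" .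
    have "prod_list A * (fps_const (a + 1) * (binom_fps x (d j) * G)) * fps_exp y =
      fps_const (a + 1) * (E * ((\<Prod>h\<in>{1..q} - {J}. binom_fps (xrow \<rho> J h) (mtilde d m j h)) * binom_fps x (d j))
        * fps_exp y * G)"
      unfolding A by (simp only: mult_ac)
    then show ?thesis
      unfolding B factor_series_def row_series_def E_def[symmetric] by (simp only: mult_ac)
  qed
  finally show ?thesis by (simp add: G_def x_def)
qed

section \<open>The components\<close>

text \<open>The case distinction keeps the index -1, where V is 0, apart from truncated subtraction
  of natural numbers.\<close>

lemma poly_V_poly_int:
  assumes Jl: "J \<in> {1..q}" "l \<in> {1..q}" "J \<noteq> l" and y: "y \<noteq> 0" and N: "N = int M - int c"
  shows "poly (V_poly p q d \<rho> \<xi> m n J l N a) y =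
    (if c \<le> M then y ^ (M - c) / fact (M - c) * V_sd p q d \<rho> \<xi> m n J l (M - c) a y else 0)"
proof (cases "c \<le> M")
  case True
  then have "N = int (M - c)" using N by (simp add: of_nat_diff)
  then show ?thesis by (simp only: True if_True poly_V_poly(2)[OF Jl y])
next
  case False
  then show ?thesis using N by (simp add: V_poly_def)
qed

lemma poly_V_poly_eq_fps_nth:
  assumes Jl: "J \<in> {1..q}" "l \<in> {1..q}" "J \<noteq> l" and y: "y \<noteq> 0" and N: "N = int M - int c"
    and a: "a > -1" and d: "d l > 0"
  shows "poly (V_poly p q d \<rho> \<xi> m n J l N a) y =
    (if c \<le> M then (a + 1) * (factor_series p q \<rho> \<xi> m n J * (row_series q d \<rho> y J *
      weighted_int a (row_series_inv q d \<rho> y J * binom_fps (xrow \<rho> J l) 1))) $ (M - c) else 0)"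
  unfolding poly_V_poly_int[OF Jl y N] V_sd_eq_fps_nth[where d = d, OF Jl y a d] ..

text \<open>The leading X of the off-diagonal kernel lowers the coefficient index from
  \<open>m J - 1\<close> to \<open>m J - 2\<close>; for \<open>m J = 1\<close> both sides vanish.
  The quotient by \<open>d J + 1\<close> cancels the factor a + 1 of the sum.\<close>

lemma off_diagonal_residue:
  assumes Jj: "J \<in> {1..q}" "j \<in> {1..q}" "J \<noteq> j" and y: "y \<noteq> 0"
    and d: "d j > 0" "d J > 0" and m: "m J \<ge> 1"
  shows "(factor_series p q \<rho> \<xi> m n J * residue_kernel q d \<rho> y j J) $ (m J - 1) =
    - (d j * (xrow \<rho> J j / (d J + 1) * poly (V_poly p q d \<rho> \<xi> m n J j (int (m J) - 2) (d J)) y))"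
proof -
  define x where "x = xrow \<rho> J j"
  define F where "F = factor_series p q \<rho> \<xi> m n J * (row_series q d \<rho> y J *
      weighted_int (d J) (row_series_inv q d \<rho> y J * binom_fps x 1))"
  have V: "poly (V_poly p q d \<rho> \<xi> m n J j (int (m J) - 2) (d J)) y =
    (if 2 \<le> m J then (d J + 1) * F $ (m J - 2) else 0)"
    unfolding F_def x_def using d by (intro poly_V_poly_eq_fps_nth Jj y) auto
  have "factor_series p q \<rho> \<xi> m n J * residue_kernel q d \<rho> y j J = fps_const (- d j * x) * (fps_X * F)"
    using Jj(3) by (simp only: residue_kernel_def F_def x_def[symmetric] if_False mult_ac)
  then have "(factor_series p q \<rho> \<xi> m n J * residue_kernel q d \<rho> y j J) $ (m J - 1) =
    - d j * x * (if 2 \<le> m J then F $ (m J - 2) else 0)"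
    using m by (auto simp: numeral_2_eq_2)
  then show ?thesis unfolding V x_def[symmetric] using d by simp
qed

text \<open>Multiplying and dividing by \<open>1 - xrow \<rho> j h * X\<close> brings the diagonal kernel into the shape of
  the kernels that the Srivastava--Daoust sums represent, for any choice of \<open>h\<close>.\<close>

lemma diagonal_residue:
  assumes jh: "j \<in> {1..q}" "h \<in> {1..q}" "j \<noteq> h" and y: "y \<noteq> 0"
    and d: "d j > 0" "d h > 0" and m: "m j \<ge> 1"
  shows "(factor_series p q \<rho> \<xi> m n j * residue_kernel q d \<rho> y j j) $ (m j - 1) =
    poly (V_poly p q d \<rho> \<xi> m n j h (int (m j) - 1) (d j - 1)) y
    - d j * xrow \<rho> j h / (d j + 1) * poly (V_poly p q d \<rho> \<xi> m n j h (int (m j) - 2) (d j)) y"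
proof -
  define x where "x = xrow \<rho> j h"
  define g where "g = row_series_inv q d \<rho> y j * binom_fps x 1"
  define F where "F a = factor_series p q \<rho> \<xi> m n j * (row_series q d \<rho> y j * weighted_int a g)" for a
  \<comment> \<open>For a = \<open>d j - 1\<close> the factor a + 1 is \<open>d j\<close>, the
    constant of the diagonal kernel, so this term needs no quotient; the one with a =
    \<open>d j\<close> does.\<close>
  have "poly (V_poly p q d \<rho> \<xi> m n j h (int (m j) - 1) (d j - 1)) y =
    (if 1 \<le> m j then (d j - 1 + 1) * F (d j - 1) $ (m j - 1) else 0)"
    unfolding F_def g_def x_def using d by (intro poly_V_poly_eq_fps_nth jh y) auto
  then have V1: "poly (V_poly p q d \<rho> \<xi> m n j h (int (m j) - 1) (d j - 1)) y = d j * F (d j - 1) $ (m j - 1)"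
    using m by simp
  have V2: "poly (V_poly p q d \<rho> \<xi> m n j h (int (m j) - 2) (d j)) y =
    (if 2 \<le> m j then (d j + 1) * F (d j) $ (m j - 2) else 0)"
    unfolding F_def g_def x_def using d by (intro poly_V_poly_eq_fps_nth jh y) auto
  have "row_series_inv q d \<rho> y j = g * (1 - fps_const x * fps_X)"
  proof -
    have "g * (1 - fps_const x * fps_X) =
      row_series_inv q d \<rho> y j * ((1 - fps_const x * fps_X) * binom_fps x 1)"
      unfolding g_def by (simp only: mult_ac)
    then show ?thesis by (simp only: binom_fps_one_cancel mult_1_right)
  qed
  then have "weighted_int (d j - 1) (row_series_inv q d \<rho> y j) =
    weighted_int (d j - 1) g - fps_const x * fps_X * weighted_int (d j) g"
    using weighted_int_linear_factor[of "d j - 1" g x] by simp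
  then have "factor_series p q \<rho> \<xi> m n j * residue_kernel q d \<rho> y j j =
    fps_const (d j) * F (d j - 1) - fps_const (d j) * (fps_const x * (fps_X * F (d j)))"
    by (simp only: residue_kernel_def F_def if_True refl right_diff_distrib mult_ac)
  then have "(factor_series p q \<rho> \<xi> m n j * residue_kernel q d \<rho> y j j) $ (m j - 1) =
    d j * F (d j - 1) $ (m j - 1) - d j * (x * (if 2 \<le> m j then F (d j) $ (m j - 2) else 0))"
    using m by (auto simp: numeral_2_eq_2)
  then show ?thesis unfolding V1 V2 x_def[symmetric] using d by simp
qed

lemma component_formula_poly:
  assumes y: "y \<noteq> 0" and jh: "j \<in> {1..q}" "h \<in> {1..q}" "j \<noteq> h"
    and d: "\<And>h. h \<in> {1..q} \<Longrightarrow> d h > 0" and m: "\<And>h. h \<in> {1..q} \<Longrightarrow> m h \<ge> 1"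
  shows "poly (component_formula p q d \<rho> \<xi> m n j h) y =
    (\<Sum>J=1..q. kappa p q \<rho> \<xi> m n J *
      (factor_series p q \<rho> \<xi> m n J * residue_kernel q d \<rho> y j J) $ (m J - 1))"
proof -
  have "(\<Sum>J=1..q. kappa p q \<rho> \<xi> m n J *
      (factor_series p q \<rho> \<xi> m n J * residue_kernel q d \<rho> y j J) $ (m J - 1)) =
    kappa p q \<rho> \<xi> m n j * (factor_series p q \<rho> \<xi> m n j * residue_kernel q d \<rho> y j j) $ (m j - 1) +
    (\<Sum>J\<in>{1..q} - {j}. kappa p q \<rho> \<xi> m n J *
      (factor_series p q \<rho> \<xi> m n J * residue_kernel q d \<rho> y j J) $ (m J - 1))"
    using jh by (intro sum.remove) auto
  also have "(\<Sum>J\<in>{1..q} - {j}. kappa p q \<rho> \<xi> m n J *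
      (factor_series p q \<rho> \<xi> m n J * residue_kernel q d \<rho> y j J) $ (m J - 1)) =
    (\<Sum>J\<in>{1..q} - {j}. - (d j * (kappa p q \<rho> \<xi> m n J * xrow \<rho> J j / (d J + 1) *
      poly (V_poly p q d \<rho> \<xi> m n J j (int (m J) - 2) (d J)) y)))"
    by (rule sum.cong[OF refl], subst off_diagonal_residue) (use jh y d m in auto)
  also have "\<dots> = - (d j * (\<Sum>J\<in>{1..q} - {j}. kappa p q \<rho> \<xi> m n J * xrow \<rho> J j / (d J + 1) *
      poly (V_poly p q d \<rho> \<xi> m n J j (int (m J) - 2) (d J)) y))"
    by (simp only: sum_negf sum_distrib_left)
  also have "(factor_series p q \<rho> \<xi> m n j * residue_kernel q d \<rho> y j j) $ (m j - 1) =
    poly (V_poly p q d \<rho> \<xi> m n j h (int (m j) - 1) (d j - 1)) y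
    - d j * xrow \<rho> j h / (d j + 1) * poly (V_poly p q d \<rho> \<xi> m n j h (int (m j) - 2) (d j)) y"
    using jh y d m by (intro diagonal_residue) auto
  finally show ?thesis
    by (simp add: component_formula_def poly_sum right_diff_distrib mult.assoc)
qed

lemma component_formula_sd_list:
  assumes jh: "j \<in> {1..q}" "h \<in> {1..q}" "j \<noteq> h" and d: "\<And>h. h \<in> {1..q} \<Longrightarrow> d h > 0"
    and m: "m j \<ge> 1"
  shows "\<exists>ts :: (real \<times> nat \<times> nat \<times> nat \<times> real) list.
       length ts \<le> q + 1 \<and>
       (\<forall>(c, J, l, N, a)\<in>set ts. J \<in> {1..q} \<and> l \<in> {1..q} \<and> J \<noteq> l \<and> a > -1 \<and>
          (\<forall>y. y \<noteq> 0 \<longrightarrow> length (V_args p q \<rho> \<xi> J l y) = p + 2 * q - 1 \<and>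
             V_sd_terminating p q d \<rho> \<xi> m n J l N a y)) \<and>
       (\<forall>y. y \<noteq> 0 \<longrightarrow> poly (component_formula p q d \<rho> \<xi> m n j h) y =
          (\<Sum>(c, J, l, N, a)\<leftarrow>ts. c * (y ^ N / fact N) * V_sd p q d \<rho> \<xi> m n J l N a y))"
proof -
  \<comment> \<open>For \<open>m J = 1\<close> the formula contains V of index -1, which is 0,
    whereas the truncated \<open>m J - 2\<close> is 0 and the sum with N = 0 equals 1; the
    coefficient must vanish instead.\<close>
  define c where "c J x = (if 2 \<le> m J then - (d j * kappa p q \<rho> \<xi> m n J * x / (d J + 1)) else 0)" for J x
  \<comment> \<open>Two terms for row j and one for each of the other q - 1 rows. The second term
    has the same shape of coefficient as the off-diagonal ones.\<close>
  define ts where "ts = (kappa p q \<rho> \<xi> m n j, j, h, m j - 1, d j - 1) #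
    (c j (xrow \<rho> j h), j, h, m j - 2, d j) #
    map (\<lambda>J. (c J (xrow \<rho> J j), J, j, m J - 2, d J)) (rows_except q {j})"
  have "length ts \<le> q + 1"
    using length_rows_except(1)[OF jh] jh by (simp add: ts_def)
  moreover have "J \<in> {1..q} \<and> l \<in> {1..q} \<and> J \<noteq> l \<and> a > -1" if "(c', J, l, N, a) \<in> set ts" for c' J l N a
    using that jh d[of J] by (auto simp: ts_def rows_except_def)
  moreover have "poly (component_formula p q d \<rho> \<xi> m n j h) y =
      (\<Sum>(c, J, l, N, a)\<leftarrow>ts. c * (y ^ N / fact N) * V_sd p q d \<rho> \<xi> m n J l N a y)" if y: "y \<noteq> 0" for y
  proof -
    define S where "S J l N a = y ^ N / fact N * V_sd p q d \<rho> \<xi> m n J l N a y" for J l N a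
    have V1: "poly (V_poly p q d \<rho> \<xi> m n j h (int (m j) - 1) (d j - 1)) y = S j h (m j - 1) (d j - 1)"
      using poly_V_poly_int[OF jh y, of _ "m j" 1] m by (simp add: S_def)
    have V2: "poly (V_poly p q d \<rho> \<xi> m n J l (int (m J) - 2) a) y = (if 2 \<le> m J then S J l (m J - 2) a else 0)"
      if "J \<in> {1..q}" "l \<in> {1..q}" "J \<noteq> l" for J l a
      using poly_V_poly_int[OF that y, of _ "m J" 2] by (simp add: S_def)
    have set_rows: "distinct (rows_except q {j})" "set (rows_except q {j}) = {1..q} - {j}"
      by (auto simp: rows_except_def)
    have "(\<Sum>(c, J, l, N, a)\<leftarrow>ts. c * (y ^ N / fact N) * V_sd p q d \<rho> \<xi> m n J l N a y) =
      kappa p q \<rho> \<xi> m n j * S j h (m j - 1) (d j - 1) + c j (xrow \<rho> j h) * S j h (m j - 2) (d j) +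
      (\<Sum>J\<leftarrow>rows_except q {j}. c J (xrow \<rho> J j) * S J j (m J - 2) (d J))"
      by (simp add: ts_def S_def comp_def mult.assoc)
    also have "(\<Sum>J\<leftarrow>rows_except q {j}. c J (xrow \<rho> J j) * S J j (m J - 2) (d J)) =
      (\<Sum>J\<in>{1..q} - {j}. c J (xrow \<rho> J j) * S J j (m J - 2) (d J))"
      unfolding set_rows(2)[symmetric] by (rule sum.distinct_set_conv_list[OF set_rows(1), symmetric])
    also have "\<dots> = - (d j * (\<Sum>J\<in>{1..q} - {j}. kappa p q \<rho> \<xi> m n J * xrow \<rho> J j / (d J + 1) *
      poly (V_poly p q d \<rho> \<xi> m n J j (int (m J) - 2) (d J)) y))"
      unfolding sum_distrib_left sum_negf[symmetric]
      using jh by (intro sum.cong refl) (auto simp: V2 c_def mult_ac)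
    finally show ?thesis
      unfolding component_formula_def
      by (simp add: poly_sum V1 V2[OF jh] c_def mult_ac)
  qed
  ultimately show ?thesis
    using length_V_args V_sd_terminates by (intro exI[of _ ts]) fastforce
qed

theorem proposition4p11:
  fixes p q :: nat
    and d \<rho> \<xi> :: "nat \<Rightarrow> real"
    and m n :: "nat \<Rightarrow> nat"
    and B :: "nat \<Rightarrow> real poly"
  assumes p: "p \<ge> 1" and q: "q \<ge> 2"
    and d_pos: "\<forall>h\<in>{1..q}. d h > 0"
    and rho_pos: "\<forall>h\<in>{1..q}. \<rho> h > 0"
    and rho_distinct: "inj_on \<rho> {1..q}"
    and xi: "\<forall>i\<in>{1..p}. \<forall>h\<in>{1..q}. \<xi> i + \<rho> h > 0"
    and m_pos: "\<forall>h\<in>{1..q}. m h \<ge> 1"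
    and near_diag: "\<forall>h\<in>{1..q}. \<forall>l\<in>{1..q}. \<bar>int (m h) - int (m l)\<bar> \<le> 1"
    and size: "(\<Sum>h=1..q. m h) = (\<Sum>i=1..p. n i) + 1"
    and deg_B: "\<forall>j\<in>{1..q}. degree (B j) \<le> m j - 1"
    and normalization: "\<forall>z::real. (\<forall>h\<in>{1..q}. z > - \<rho> h) \<longrightarrow>
      (LINT y:{0..}|lborel. exp (- z * y) * linear_form q d \<rho> B y) =
        - ((\<Prod>i=1..p. (\<xi> i - z) ^ n i) / (\<Prod>h=1..q. (z + \<rho> h) powr (d h + real (m h))))"
  shows "\<forall>j\<in>{1..q}.
    (\<forall>h\<in>{1..q} - {j}. B j = component_formula p q d \<rho> \<xi> m n j h) \<and>
    (\<forall>h\<in>{1..q} - {j}. \<forall>h'\<in>{1..q} - {j}.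
       component_formula p q d \<rho> \<xi> m n j h = component_formula p q d \<rho> \<xi> m n j h') \<and>
    (\<forall>h\<in>{1..q} - {j}. degree (component_formula p q d \<rho> \<xi> m n j h) \<le> m j - 1) \<and>
    (\<exists>ts :: (real \<times> nat \<times> nat \<times> nat \<times> real) list.
       length ts \<le> q + 1 \<and>
       (\<forall>(c, J, l, N, a)\<in>set ts. J \<in> {1..q} \<and> l \<in> {1..q} \<and> J \<noteq> l \<and> a > -1 \<and>
          (\<forall>y. y \<noteq> 0 \<longrightarrow> length (V_args p q \<rho> \<xi> J l y) = p + 2 * q - 1 \<and>
             V_sd_terminating p q d \<rho> \<xi> m n J l N a y)) \<and>
       (\<forall>y. y \<noteq> 0 \<longrightarrow> poly (B j) y =
          (\<Sum>(c, J, l, N, a)\<leftarrow>ts. c * (y ^ N / fact N) * V_sd p q d \<rho> \<xi> m n J l N a y)))"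
proof -
  \<comment> \<open>The rightmost pole: the normalization is assumed exactly for z > z0.\<close>
  define z0 where "z0 = Max ((\<lambda>h. - \<rho> h) ` {1..q})"
  have z0_ge: "- \<rho> h \<le> z0" if "h \<in> {1..q}" for h
    unfolding z0_def using that by (intro Max_ge) auto
  have eq: "B j = component_formula p q d \<rho> \<xi> m n j h" if j: "j \<in> {1..q}" and h: "h \<in> {1..q} - {j}" for j h
  proof (rule poly_eq_off_zero)
    \<comment> \<open>The sums contain 1/y, so the two polynomials are compared at y different from
      0; the functional and its kernels are built anew for each such y.\<close>
    fix y :: real assume y: "y \<noteq> 0"
    interpret row_data q d \<rho> z0 y j
      by unfold_locales (use d_pos rho_distinct z0_ge j in auto)
    have "poly (B j) y = (\<Sum>J=1..q. kappa p q \<rho> \<xi> m n J *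
        (factor_series p q \<rho> \<xi> m n J * residue_kernel q d \<rho> y j J) $ (m J - 1))"
    proof (rule component_eq_residue_sum)
      fix z assume "z > z0"
      then have "\<forall>h\<in>{1..q}. z > - \<rho> h" using z0_ge by (meson order.strict_trans1)
      then show "(LINT t:{0..}|lborel. exp (- z * t) * linear_form q d \<rho> B t) =
        - ((\<Prod>i=1..p. (\<xi> i - z) ^ n i) / (\<Prod>h=1..q. (z + \<rho> h) powr (d h + real (m h))))"
        using normalization by blast
    qed (use m_pos xi in blast)+
    also have "\<dots> = poly (component_formula p q d \<rho> \<xi> m n j h) y"
      using h j d_pos m_pos y by (intro component_formula_poly[symmetric]) auto
    finally show "poly (B j) y = poly (component_formula p q d \<rho> \<xi> m n j h) y" .
  qed
  show ?thesis
  proof (intro ballI conjI, goal_cases)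
    case (1 j h)
    then show ?case by (rule eq)
  next
    case (2 j h h')
    then show ?case using eq by metis
  next
    case (3 j h)
    then show ?case using eq deg_B by metis
  next
    case (4 j)
    have "\<exists>h. h \<in> {1..q} - {j}"
      using q by (intro exI[of _ "if j = 1 then 2 else 1"]) auto
    then obtain h where h: "h \<in> {1..q}" "j \<noteq> h" by blast
    then have B: "B j = component_formula p q d \<rho> \<xi> m n j h" using eq 4 by blast
    have "m j \<ge> 1" using m_pos 4 by blast
    with d_pos show ?case
      unfolding B by (intro component_formula_sd_list 4 h) auto
  qed
qed

end
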